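(* Let $L$ be a finite-dimensional Leibniz $n$-algebra over a field $\mathbb{K}$ of characteristic zero and let $1\le s\le n$. If $J$ is the $s$-nilradical of $L$, then $d(J)\subseteq J$ for every derivation $d$ of $L$. Likewise, if $J$ is the nilradical of $L$, then $d(J)\subseteq J$ for every derivation $d$ of $L$.
   Context: A Leibniz $n$-algebra is a vector space $L$ with an $n$-linear multiplication $[-,\dots,-]$ satisfying $[[x_1,\dots,x_n],y_2,\dots,y_n]=\sum_{i=1}^n[x_1,\dots,x_{i-1},[x_i,y_2,\dots,y_n],x_{i+1},\dots,x_n]$. A derivation is a linear map $d:L\to L$ with $d([x_1,\dots,x_n])=\sum_{i=1}^n[x_1,\dots,d(x_i),\dots,x_n]$. An ideal is a subspace $I$ such that a product of $n$ elements lies in $I$ whenever at least one of the factors (in any position) lies in $I$. For a Leibniz $n$-algebra $H$ (in particular, for an ideal $H$ of $L$ regarded as a Leibniz $n$-algebra) put $H^{<1>_s}=H$, $H^{<m+1>_s}=[H,\dots,H,H^{<m>_s},H,\dots,H]$ with $H^{<m>_s}$ in position $s$ (linear span of products), and $H^1=H$, $H^{m+1}=\sum_{i=1}^n[H,\dots,H,H^m,H,\dots,H]$ with $H^m$ in position $i$. $H$ is $s$-nilpotent (nilpotent) if $H^{<m>_s}=0$ ($H^m=0$, respectively) for some $m$. The $s$-nilradical (nilradical) of a finite-dimensional $L$ is the maximal $s$-nilpotent (nilpotent, respectively) ideal of $L$, defined as the sum of all $s$-nilpotent (nilpotent, respectively) ideals of $L$. *)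

theory Defs
  imports Complex_Main
begin

text \<open>An \<open>n\<close>-tuple \<open>(x\<^sub>1,\<dots>,x\<^sub>n)\<close> over \<open>L\<close> is represented by a function on \<open>nat\<close> of which only the
  values at \<open>1,\<dots>,n\<close> matter; \<open>bracket_cong\<close> makes \<open>br\<close> a map on such tuples.  Replacing the entry in
  position \<open>i\<close> is the update \<open>x(i := v)\<close>; in particular \<open>[v, y\<^sub>2, \<dots>, y\<^sub>n]\<close> is \<open>br (y(1 := v))\<close>.\<close>

locale leibniz_n_algebra = vector_space scale
  for scale :: "'k::field \<Rightarrow> 'v::ab_group_add \<Rightarrow> 'v" +
  fixes n :: nat
    and br :: "(nat \<Rightarrow> 'v) \<Rightarrow> 'v"
  assumes bracket_cong: "(\<And>i. i \<in> {1..n} \<Longrightarrow> x i = y i) \<Longrightarrow> br x = br y"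
    and bracket_linear: "i \<in> {1..n} \<Longrightarrow> Vector_Spaces.linear scale scale (\<lambda>v. br (x(i := v)))"
    and leibniz_identity: "br (y(1 := br x)) = (\<Sum>i\<in>{1..n}. br (x(i := br (y(1 := x i)))))"
begin

definition derivation :: "('v \<Rightarrow> 'v) \<Rightarrow> bool" where
  "derivation d \<longleftrightarrow> Vector_Spaces.linear scale scale d \<and>
     (\<forall>x. d (br x) = (\<Sum>i\<in>{1..n}. br (x(i := d (x i)))))"

definition leibniz_ideal :: "'v set \<Rightarrow> bool" where
  "leibniz_ideal I \<longleftrightarrow> subspace I \<and> (\<forall>x. (\<exists>i\<in>{1..n}. x i \<in> I) \<longrightarrow> br x \<in> I)"

definition subspace_sum :: "'v set set \<Rightarrow> 'v set" where
  "subspace_sum \<S> = span (\<Union>\<S>)"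

text \<open>\<open>[A\<^sub>1, \<dots>, A\<^sub>n]\<close>\<close>
definition bracket_span :: "(nat \<Rightarrow> 'v set) \<Rightarrow> 'v set" where
  "bracket_span A = span {br x |x. \<forall>i\<in>{1..n}. x i \<in> A i}"

text \<open>The two series are indexed from \<open>0\<close>: \<open>s_series s H m\<close> is \<open>H\<^bsup><m+1>\<^esup>\<close> taken in position \<open>s\<close>, and
  \<open>lower_series H m\<close> is \<open>H\<^bsup>m+1\<^esup>\<close>.\<close>
primrec s_series :: "nat \<Rightarrow> 'v set \<Rightarrow> nat \<Rightarrow> 'v set" where
  "s_series s H 0 = H"
| "s_series s H (Suc m) = bracket_span ((\<lambda>_. H)(s := s_series s H m))"

primrec lower_series :: "'v set \<Rightarrow> nat \<Rightarrow> 'v set" where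
  "lower_series H 0 = H"
| "lower_series H (Suc m) =
     subspace_sum ((\<lambda>i. bracket_span ((\<lambda>_. H)(i := lower_series H m))) ` {1..n})"

definition s_nilpotent :: "nat \<Rightarrow> 'v set \<Rightarrow> bool" where
  "s_nilpotent s H \<longleftrightarrow> (\<exists>m. s_series s H m = {0})"

definition nilpotent :: "'v set \<Rightarrow> bool" where
  "nilpotent H \<longleftrightarrow> (\<exists>m. lower_series H m = {0})"

definition s_nilradical :: "nat \<Rightarrow> 'v set" where
  "s_nilradical s = subspace_sum {I. leibniz_ideal I \<and> s_nilpotent s I}"

definition nilradical :: "'v set" where
  "nilradical = subspace_sum {I. leibniz_ideal I \<and> nilpotent I}"

end

end

theory Submission
  imports Defs "HOL-Algebra.Algebraic_Closure_Type" "HOL-Library.Function_Algebras"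
begin

text \<open>For \<open>n \<ge> 3\<close> a sum of two nilpotent ideals need not be nilpotent, so the usual argument, which shows
  that \<open>I + d(I)\<close> is a nilpotent ideal, breaks down.  Instead, automorphisms permute the
  (\<open>s\<close>-)nilpotent ideals, hence \<open>J\<close> is stable under all automorphisms of \<open>L\<close>, and it suffices that a
  subspace with this property is stable under every derivation \<open>d\<close>.

  Over the algebraic closure, \<open>L\<close> is the sum of the generalized eigenspaces \<open>L\<^sub>\<alpha>\<close> of \<open>d\<close>.  The operator
  acting on \<open>L\<^sub>\<alpha>\<close> as \<open>exp (- t N (d - \<alpha>)) * (\<Prod>\<beta>. (1 - t \<beta>) powi C \<alpha> \<beta>)\<close>, with \<open>\<beta>\<close> ranging over the
  eigenvalues, is an automorphism if the integers \<open>C \<alpha> \<beta>\<close> are additive in \<open>\<alpha>\<close>.  They can be chosen invariant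
  under the Galois group and such that \<open>(\<Sum>\<beta>. C \<alpha> \<beta> * \<beta>) = N * \<alpha>\<close>.  By the former, the automorphism is
  defined over the base field whenever \<open>t\<close> is; by the latter, its derivative at \<open>t = 0\<close> is \<open>- N * d\<close>.
  Up to a scalar factor it is polynomial in \<open>t\<close>, so a linear form vanishing on \<open>J\<close>, which kills
  the images of \<open>J\<close> for infinitely many \<open>t\<close>, also kills \<open>d(J)\<close>.\<close>

text \<open>A scalar function g on the eigenvalues acts as a diagonal automorphism as soon as it
  turns each sum of n eigenvalues that is again an eigenvalue into the product of the values.
  Products of fixed nonzero numbers with additive integer exponents have this property. The factors
  1 - t \<beta> are chosen because their logarithmic derivative at t = 0 is -\<beta>: with the
  exponents \<open>C\<close> the diagonal part contributes -N \<alpha>, the exponential contributes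
  -N (d - \<alpha>), and \<alpha> cancels. N is the common denominator of the rational coordinates
  behind \<open>C\<close>. Characteristic zero enters four times: in the factorials, in the
  separability behind descent, in the rational scalars with their positive definite form that single
  out the coordinates, and in the infinitely many distinct integers t.\<close>

section \<open>Embeddings of the algebraic closure over the base field\<close>

text \<open>A partial field embedding is kept as its graph, so that extension is set inclusion and
  chains have their union as upper bound. As -1 lies in the base, the last clause already makes the
  graph single-valued; closure under inverses follows from algebraicity.\<close>

definition partial_embedding :: "('k::field alg_closure \<times> 'k alg_closure) set \<Rightarrow> bool" where
  "partial_embedding R \<longleftrightarrow> (\<forall>k. (to_ac k, to_ac k) \<in> R)
     \<and> (\<forall>a b a' b'. (a, b) \<in> R \<longrightarrow> (a', b') \<in> R \<longrightarrow> (a + a', b + b') \<in> R \<and> (a * a', b * b') \<in> R)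
     \<and> (\<forall>b. (0, b) \<in> R \<longrightarrow> b = 0)"

text \<open>\<open>g\<close> is what results from applying the partial embedding to the coefficients
  of \<open>f\<close>; no type of polynomials over the domain of \<open>R\<close> has to be
  introduced.\<close>

definition poly_rel :: "('a::zero \<times> 'a) set \<Rightarrow> 'a poly \<Rightarrow> 'a poly \<Rightarrow> bool" where
  "poly_rel R f g \<longleftrightarrow> (\<forall>i. (coeff f i, coeff g i) \<in> R)"

context
  fixes R :: "('k::field alg_closure \<times> 'k alg_closure) set"
  assumes R: "partial_embedding R"
begin

lemma pe_to_ac: "(to_ac k, to_ac k) \<in> R"
  using R by (auto simp: partial_embedding_def)

lemma pe_0: "(0, 0) \<in> R" and pe_1: "(1, 1) \<in> R" 
  using pe_to_ac[of 0] pe_to_ac[of 1] by simp_all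

lemma pe_add: "(a, b) \<in> R \<Longrightarrow> (a', b') \<in> R \<Longrightarrow> (a + a', b + b') \<in> R"
  and pe_mult: "(a, b) \<in> R \<Longrightarrow> (a', b') \<in> R \<Longrightarrow> (a * a', b * b') \<in> R"
  and pe_zeroD: "(0, b) \<in> R \<Longrightarrow> b = 0"
  using R unfolding partial_embedding_def by blast+

lemma pe_uminus: "(a, b) \<in> R \<Longrightarrow> (- a, - b) \<in> R"
  using pe_mult[OF pe_to_ac[of "-1"], of a b] by simp

lemma pe_diff: "(a, b) \<in> R \<Longrightarrow> (a', b') \<in> R \<Longrightarrow> (a - a', b - b') \<in> R"
  using pe_add[OF _ pe_uminus, of a b a' b'] by simp

lemma pe_unique: "(a, b) \<in> R \<Longrightarrow> (a, b') \<in> R \<Longrightarrow> b = b'"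
  using pe_zeroD[of "b - b'"] pe_diff[of a b a b'] by simp

lemma pe_sum: "(\<And>i. i \<in> S \<Longrightarrow> (f i, g i) \<in> R) \<Longrightarrow> (sum f S, sum g S) \<in> R"
  by (induction S rule: infinite_finite_induct) (auto intro: pe_add pe_0)

lemma pe_poly:
  assumes "(a, b) \<in> R" and "poly_rel R f g" shows "(poly f a, poly g b) \<in> R"
  using assms(2)
proof (induction f arbitrary: g)
  case 0
  then have "g = 0"
    by (intro poly_eqI) (auto simp: poly_rel_def intro: pe_zeroD)
  then show ?case by (simp add: pe_0)
next
  case (pCons c f)
  obtain d h where g: "g = pCons d h" by (cases g)
  have "(c, d) \<in> R" using pCons.prems by (auto simp: poly_rel_def g dest: spec[of _ 0])
  moreover have "poly_rel R f h"
    unfolding poly_rel_def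
  proof
    fix i show "(coeff f i, coeff h i) \<in> R"
      using pCons.prems[unfolded poly_rel_def g, rule_format, of "Suc i"] by simp
  qed
  ultimately show ?case
    using pCons.IH[of h] assms(1) by (simp add: g pe_add pe_mult)
qed

lemma poly_rel_map: "poly_rel R (map_poly to_ac p) (map_poly to_ac p)"
  by (simp add: poly_rel_def coeff_map_poly pe_to_ac)

lemma poly_rel_add: "poly_rel R f g \<Longrightarrow> poly_rel R f' g' \<Longrightarrow> poly_rel R (f + f') (g + g')"
  and poly_rel_diff: "poly_rel R f g \<Longrightarrow> poly_rel R f' g' \<Longrightarrow> poly_rel R (f - f') (g - g')"
  and poly_rel_mult: "poly_rel R f g \<Longrightarrow> poly_rel R f' g' \<Longrightarrow> poly_rel R (f * f') (g * g')"
  and poly_rel_monom: "(a, b) \<in> R \<Longrightarrow> poly_rel R (monom a n) (monom b n)"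
  and poly_rel_0_left: "poly_rel R 0 g \<Longrightarrow> g = 0"
  by (auto simp: poly_rel_def coeff_mult poly_eq_iff intro!: pe_add pe_diff pe_mult pe_sum pe_zeroD pe_0)

text \<open>The inverse of an algebraic \<open>a\<close> is a polynomial in \<open>a\<close> over
  the base, and values of such polynomials are related by \<open>pe_poly\<close>. To find it, strip
  factors X from an annihilating polynomial, which is possible as \<open>a\<close> is nonzero, until
  the constant term is nonzero; then solve for that term.\<close>

lemma pe_inverse:
  assumes "(a, b) \<in> R" "a \<noteq> 0" shows "(inverse a, inverse b) \<in> R" "b \<noteq> 0"
proof -
  have ex: "\<exists>q :: 'k poly. poly (map_poly to_ac q) a = inverse a" if "p \<noteq> 0" "poly (map_poly to_ac p) a = 0"
    for p :: "'k poly"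
    using that
  proof (induction p)
    case (pCons c p)
    have e: "to_ac c + a * poly (map_poly to_ac p) a = 0"
      using pCons.prems by (simp add: map_poly_pCons)
    show ?case
    proof (cases "c = 0")
      case True
      with e pCons assms show ?thesis by auto
    next
      case False
      have "poly (map_poly to_ac (smult (- inverse c) p)) a = - inverse (to_ac c) * poly (map_poly to_ac p) a"
        by (subst map_poly_smult) simp_all
      also have "\<dots> = inverse a"
      proof -
        have "a * poly (map_poly to_ac p) a = - to_ac c" using e by (simp add: eq_neg_iff_add_eq_0 add.commute)
        then have "inverse a * (a * poly (map_poly to_ac p) a) = - (inverse a * to_ac c)" by simp
        then have "poly (map_poly to_ac p) a = - (inverse a * to_ac c)" using assms(2) by (simp flip: mult.assoc)
        then show ?thesis using False by simp
      qed
      finally show ?thesis by blast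
    qed
  qed auto
  obtain q :: "'k poly" where q: "poly (map_poly to_ac q) a = inverse a"
    using ex alg_closure_algebraic[of a] by metis
  define z where "z = poly (map_poly to_ac q) b"
  have z: "(inverse a, z) \<in> R"
    using pe_poly[OF assms(1) poly_rel_map, of q] q by (simp add: z_def)
  have "(1, b * z) \<in> R" using pe_mult[OF assms(1) z] assms(2) by simp
  then have "b * z = 1" using pe_unique pe_1 by blast
  then show "b \<noteq> 0" "(inverse a, inverse b) \<in> R" using z inverse_unique[of b z] by auto
qed

text \<open>Zero is related only to zero in both directions, the second by
  \<open>pe_inverse\<close>, so leading coefficients neither vanish nor appear.\<close>

lemma pe_degree: "poly_rel R f g \<Longrightarrow> degree g = degree f"
proof (rule antisym)
  assume r: "poly_rel R f g"
  show "degree g \<le> degree f"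
  proof (rule degree_le, safe)
    fix i assume "degree f < i"
    then show "coeff g i = 0"
      using r pe_zeroD[of "coeff g i"] coeff_eq_0[of f i] unfolding poly_rel_def by metis
  qed
  show "degree f \<le> degree g"
  proof (rule degree_le, safe)
    fix i assume "degree g < i"
    then show "coeff f i = 0" 
      using r pe_inverse(2)[of "coeff f i" 0] coeff_eq_0[of g i] unfolding poly_rel_def by metis
  qed
qed

text \<open>Adjunction of a root: \<open>f\<close> is in effect the minimal polynomial of
  \<open>a\<close> over the domain of \<open>R\<close>, \<open>g\<close> its image, and the value of
  \<open>u\<close> at \<open>a\<close> is sent to the value of \<open>v\<close> at \<open>b\<close>.
  This is well defined because a \<open>u\<close> vanishing at \<open>a\<close> can be divided by
  \<open>f\<close>, and the division is copied step by step on the image side.\<close>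

lemma pe_extend:
  assumes f: "poly_rel R f g" "f \<noteq> 0" "poly f a = 0"
    and min: "\<And>u v. poly_rel R u v \<Longrightarrow> u \<noteq> 0 \<Longrightarrow> poly u a = 0 \<Longrightarrow> degree f \<le> degree u"
    and b: "poly g b = 0"
  obtains R' where "partial_embedding R'" "R \<subseteq> R'" "(a, b) \<in> R'"
proof -
  define R' where "R' = {(poly u a, poly v b) |u v. poly_rel R u v}"
  have z: "poly v b = 0" if "poly_rel R u v" "poly u a = 0" for u v
    using that
  proof (induction "degree u" arbitrary: u v rule: less_induct)
    case less
    show ?case
    proof (cases "u = 0")
      case True
      then show ?thesis using less.prems poly_rel_0_left by force
    next
      case False
      have le: "degree f \<le> degree u" using min less.prems False by blast
      have c: "(lead_coeff f, coeff g (degree f)) \<in> R" "(lead_coeff u, coeff v (degree u)) \<in> R"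
        using f(1) less.prems(1) by (auto simp: poly_rel_def)
      \<comment> \<open>On the image side the coefficients are taken at the degrees of
        \<open>f\<close> and \<open>u\<close>, where \<open>poly_rel\<close> relates them to the
        leading coefficients directly.\<close>
      define c c' where "c = lead_coeff u * inverse (lead_coeff f)"
        and "c' = coeff v (degree u) * inverse (coeff g (degree f))"
      have cc: "(c, c') \<in> R"
        unfolding c_def c'_def using f(2) by (intro pe_mult[OF c(2) pe_inverse(1)[OF c(1)]]) simp
      define w w' where "w = monom c (degree u - degree f)" and "w' = monom c' (degree u - degree f)"
      have r: "poly_rel R (u - w * f) (v - w' * g)"
        unfolding w_def w'_def by (intro poly_rel_diff poly_rel_mult poly_rel_monom less.prems f(1) cc)
      have p: "poly (u - w * f) a = 0" "poly (v - w' * g) b = poly v b"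
        using less.prems f b by simp_all
      have "u - w * f = 0 \<or> degree (u - w * f) < degree u"
      \<comment> \<open>A nonzero constant has no root, so the cancelled leading term has positive
        degree and the degree really drops.\<close>
      proof (cases "degree u = 0")
        case True
        then obtain k where "u = [:k:]" by (elim degree_eq_zeroE)
        then show ?thesis using less.prems False by simp
      next
        case False
        have "c \<noteq> 0" using f(2) \<open>u \<noteq> 0\<close> by (simp add: c_def)
        have "degree (u - w * f) < degree u"
        proof (rule degree_lessI)
          show "u - w * f \<noteq> 0 \<or> 0 < degree u" using False by simp
          show "\<forall>k\<ge>degree u. coeff (u - w * f) k = 0"
          proof (intro allI impI)
            fix k assume k: "degree u \<le> k"
            have dw: "degree (w * f) = degree u"
              using \<open>c \<noteq> 0\<close> f(2) le by (simp add: w_def degree_mult_eq degree_monom_eq monom_eq_0_iff)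
            show "coeff (u - w * f) k = 0"
            proof (cases "k = degree u")
              case True
              have "coeff (w * f) (degree u) = lead_coeff (w * f)" by (simp add: dw)
              also have "\<dots> = c * lead_coeff f"
                using \<open>c \<noteq> 0\<close> by (simp add: lead_coeff_mult w_def degree_monom_eq)
              also have "\<dots> = lead_coeff u" using f(2) by (simp add: c_def)
              finally show ?thesis using True by simp
            next
              case False
              then show ?thesis using k dw by (simp add: coeff_eq_0)
            qed
          qed
        qed
        then show ?thesis ..
      qed
      then show ?thesis
      proof
        assume "u - w * f = 0"
        then have "v - w' * g = 0" using r by (intro poly_rel_0_left) simp
        then show ?thesis using p(2) by simp
      next
        assume "degree (u - w * f) < degree u"
        then show ?thesis using less.hyps[OF _ r p(1)] p(2) by simp
      qed
    qed
  qed
  have "partial_embedding R'"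
    unfolding partial_embedding_def
  proof (intro conjI allI impI)
    fix k show "(to_ac k, to_ac k) \<in> R'"
      unfolding R'_def using poly_rel_monom[OF pe_to_ac[of k], of 0]
      by (intro CollectI exI[of _ "monom (to_ac k) 0"]) (auto simp: monom_0)
  next
    fix x y x' y' assume "(x, y) \<in> R'" "(x', y') \<in> R'"
    then obtain u v u' v' where uv: "poly_rel R u v" "poly_rel R u' v'"
      and xy: "x = poly u a" "y = poly v b" "x' = poly u' a" "y' = poly v' b"
      unfolding R'_def by blast
    show "(x + x', y + y') \<in> R'"
      unfolding R'_def xy using poly_rel_add[OF uv] by (intro CollectI exI conjI) (auto simp only: poly_add)
    show "(x * x', y * y') \<in> R'"
      unfolding R'_def xy using poly_rel_mult[OF uv] by (intro CollectI exI conjI) (auto simp only: poly_mult)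
  next
    fix y assume "(0, y) \<in> R'" then show "y = 0" using z by (auto simp: R'_def)
  qed
  moreover have "R \<subseteq> R'"
  proof clarify
    fix x y assume "(x, y) \<in> R"
    then have "poly_rel R (monom x 0) (monom y 0)" by (rule poly_rel_monom)
    then show "(x, y) \<in> R'" unfolding R'_def
      by (intro CollectI exI[of _ "monom x 0"] exI[of _ "monom y 0"]) (auto simp: monom_0)
  qed
  moreover have "(a, b) \<in> R'"
    unfolding R'_def using poly_rel_monom[OF pe_1, of 1] by (force simp: poly_monom)
  ultimately show ?thesis by (rule that)
qed

text \<open>Every \<open>a\<close> is algebraic over the base, so some polynomial of least degree
  with a related image annihilates it. The image has the same positive degree, hence a root in the
  closure, and \<open>pe_extend\<close> would enlarge \<open>R\<close> by \<open>a\<close>.\<close>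

lemma pe_extend_total:
  assumes max: "\<And>R'. partial_embedding R' \<Longrightarrow> R \<subseteq> R' \<Longrightarrow> R' = R"
  shows "\<exists>b. (a, b) \<in> R"
proof -
  define P where "P f \<longleftrightarrow> f \<noteq> 0 \<and> poly f a = 0 \<and> (\<exists>g. poly_rel R f g)" for f
  obtain p :: "'k poly" where "p \<noteq> 0" "poly (map_poly to_ac p) a = 0"
    by (rule alg_closure_algebraic)
  then have "P (map_poly to_ac p)"
    using poly_rel_map by (auto simp: P_def poly_eq_iff coeff_map_poly)
  then have "P (arg_min degree P)" "\<And>f. P f \<Longrightarrow> degree (arg_min degree P) \<le> degree f"
    using arg_min_natI arg_min_nat_le by metis+
  then obtain f where f: "P f" "\<And>u. P u \<Longrightarrow> degree f \<le> degree u" by blast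
  then obtain g where g: "poly_rel R f g" by (auto simp: P_def)
  have "degree f \<noteq> 0" using f(1) unfolding P_def by (metis degree_eq_zeroE mult_zero_right poly_pCons poly_0 add_0_right pCons_0_0)
  then have "degree g > 0" using pe_degree[OF g] by simp
  then obtain b where b: "poly g b = 0" using alg_closed_imp_poly_has_root by blast
  obtain R' where "partial_embedding R'" "R \<subseteq> R'" "(a, b) \<in> R'"
    by (rule pe_extend[OF g _ _ _ b]) (use f in \<open>auto simp: P_def\<close>)
  then show ?thesis using max by blast
qed

end

text \<open>These maps stand in for the Galois group. They are injective, so on a finite set that
  they map into itself they are permutations.\<close>

definition embedding_over_base :: "('k::field alg_closure \<Rightarrow> 'k alg_closure) \<Rightarrow> bool" where
  "embedding_over_base \<sigma> \<longleftrightarrow> (\<forall>a b. \<sigma> (a + b) = \<sigma> a + \<sigma> b \<and> \<sigma> (a * b) = \<sigma> a * \<sigma> b)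
     \<and> (\<forall>k. \<sigma> (to_ac k) = to_ac k)"

text \<open>Zorn's lemma on the graphs containing \<open>R\<close>; a maximal one is total by
  \<open>pe_extend_total\<close> and single-valued, hence a function.\<close>

lemma pe_extends_to_embedding:
  fixes R :: "('k::field alg_closure \<times> 'k alg_closure) set"
  assumes "partial_embedding R"
  obtains \<sigma> where "embedding_over_base \<sigma>" "\<And>a b. (a, b) \<in> R \<Longrightarrow> \<sigma> a = b"
proof -
  define AA where "AA = {R'. partial_embedding R' \<and> R \<subseteq> R'}"
  have "\<exists>T\<in>AA. \<forall>Y\<in>AA. T \<subseteq> Y \<longrightarrow> Y = T"
  proof (rule subset_Zorn_nonempty)
    show "AA \<noteq> {}" using assms by (auto simp: AA_def)
  next
    fix CC assume ne: "CC \<noteq> {}" and ch: "subset.chain AA CC"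
    have C: "partial_embedding Y" "R \<subseteq> Y" if "Y \<in> CC" for Y
      using that ch by (auto simp: subset.chain_def AA_def)
    \<comment> \<open>Closure under sums and products involves two pairs at a time; in a chain both
      lie in a common member.\<close>
    have dir: "\<exists>Y\<in>CC. u \<in> Y \<and> v \<in> Y" if "u \<in> \<Union>CC" "v \<in> \<Union>CC" for u v
      using that subset.chain_total[OF ch] by blast
    have "partial_embedding (\<Union>CC)"
      unfolding partial_embedding_def
    proof (intro conjI allI impI)
      fix k show "(to_ac k, to_ac k) \<in> \<Union>CC" using ne C pe_to_ac by blast
    next
      fix x y x' y' assume "(x, y) \<in> \<Union>CC" "(x', y') \<in> \<Union>CC"
      then obtain Y where "Y \<in> CC" "(x, y) \<in> Y" "(x', y') \<in> Y" using dir by blast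
      then show "(x + x', y + y') \<in> \<Union>CC" "(x * x', y * y') \<in> \<Union>CC"
        using pe_add pe_mult C by blast+
    next
      fix y assume "(0, y) \<in> \<Union>CC" then show "y = 0" using C pe_zeroD by blast
    qed
    then show "\<Union>CC \<in> AA" using ne C by (auto simp: AA_def)
  qed
  then obtain M where M: "partial_embedding M" "R \<subseteq> M"
    and max: "\<And>Y. partial_embedding Y \<Longrightarrow> M \<subseteq> Y \<Longrightarrow> Y = M"
    by (auto simp: AA_def)
  have "\<exists>\<sigma>. \<forall>a. (a, \<sigma> a) \<in> M"
    using pe_extend_total[OF M(1) max] by metis
  then obtain \<sigma> where \<sigma>: "(a, \<sigma> a) \<in> M" for a by blast
  have u: "\<sigma> a = b" if "(a, b) \<in> M" for a b
    using pe_unique[OF M(1) \<sigma> that] .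
  show ?thesis
  proof (rule that)
    show "embedding_over_base \<sigma>"
      unfolding embedding_over_base_def using pe_add[OF M(1) \<sigma> \<sigma>] pe_mult[OF M(1) \<sigma> \<sigma>] pe_to_ac[OF M(1)] u
      by blast
    show "\<sigma> a = b" if "(a, b) \<in> R" for a b using that M(2) u by blast
  qed
qed

text \<open>The minimal polynomial of an element outside the base has degree at least 2 and, by
  separability, a second root \<open>b\<close>; sending \<open>y\<close> to \<open>b\<close> extends
  to an embedding that moves \<open>y\<close>.\<close>

lemma fixed_by_embeddings_imp_base:
  fixes y :: "'k::field_char_0 alg_closure"
  assumes fixed: "\<And>\<sigma>. embedding_over_base \<sigma> \<Longrightarrow> \<sigma> y = y"
  shows "y \<in> range to_ac"
proof (rule ccontr)
  assume y: "y \<notin> range to_ac"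
  define R where "R = range (\<lambda>k :: 'k. (to_ac k, to_ac k))"
  have R: "partial_embedding R"
    unfolding partial_embedding_def R_def by (auto simp: image_iff to_ac_add[symmetric] to_ac_mult[symmetric] simp del: to_ac_add to_ac_mult)
  have rel: "\<exists>p. u = map_poly to_ac p \<and> v = map_poly to_ac p" if "poly_rel R u v" for u v
    by (rule exI[of _ "map_poly of_ac u"])
      (use that in \<open>auto simp: poly_eq_iff coeff_map_poly poly_rel_def R_def image_iff; metis of_ac_to_ac\<close>)
  define P :: "'k poly \<Rightarrow> bool" where "P p \<longleftrightarrow> p \<noteq> 0 \<and> poly (map_poly to_ac p) y = 0" for p
  have "Ex P" using alg_closure_algebraic[of y] unfolding P_def by metis
  then have "P (arg_min degree P)" "\<And>f. P f \<Longrightarrow> degree (arg_min degree P) \<le> degree f"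
    using arg_min_natI arg_min_nat_le by metis+
  then obtain p where p: "P p" and min: "\<And>q. P q \<Longrightarrow> degree p \<le> degree q" by blast
  define f where "f = map_poly to_ac p"
  have f: "poly f y = 0" "f \<noteq> 0" "degree f = degree p"
    using p by (auto simp: f_def P_def poly_eq_iff coeff_map_poly intro: degree_map_poly)
  obtain h where h: "f = [:-y, 1:] * h" using f(1) by (metis poly_eq_0_iff_dvd dvdE)
  have dp: "degree p > 1"
  proof (rule ccontr)
    assume "\<not> degree p > 1"
    then obtain a b where ab: "p = [:a, b:]"
      by (metis degree1_coeffs degree_eq_zeroE less_one linorder_neqE_nat pCons_0_0)
    have e: "to_ac a + y * to_ac b = 0" using f(1) by (simp add: f_def ab map_poly_pCons)
    have "b \<noteq> 0" using p e ab by (auto simp: P_def)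
    then have "y = to_ac (- a / b)" using e by (simp add: field_simps eq_neg_iff_add_eq_0)
    then show False using y by blast
  qed
  have "h \<noteq> 0" using h f(2) by auto
  then have "degree h > 0" using dp f(3) h by (simp add: degree_mult_eq del: mult_pCons_left)
  then obtain b where b: "poly h b = 0" using alg_closed_imp_poly_has_root by blast
  \<comment> \<open>A double root would also be a root of the derivative, which in characteristic
    zero is nonzero and of smaller degree, against minimality of \<open>p\<close>.\<close>
  have "b \<noteq> y"
  proof
    assume "b = y"
    have "pderiv f = map_poly to_ac (pderiv p)"
      by (rule poly_eqI) (simp add: coeff_pderiv coeff_map_poly f_def)
    moreover have "poly (pderiv f) y = 0"
      using b \<open>b = y\<close> unfolding h pderiv_mult by simp
    moreover have "pderiv p \<noteq> 0" "degree (pderiv p) < degree p"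
      using dp by (auto simp: pderiv_eq_0_iff degree_pderiv)
    ultimately show False using min[of "pderiv p"] by (simp add: P_def)
  qed
  have g: "poly f b = 0" using b by (simp add: h)
  have pr: "poly_rel R f f" unfolding f_def by (rule poly_rel_map[OF R])
  obtain R' where R': "partial_embedding R'" "R \<subseteq> R'" "(y, b) \<in> R'"
  proof (rule pe_extend[OF R pr f(2,1) _ g])
    fix u v assume u: "poly_rel R u v" "u \<noteq> 0" "poly u y = 0"
    then obtain q where q: "u = map_poly to_ac q" using rel by blast
    have "q \<noteq> 0" using u(2) q by auto
    then have "P q" using u(3) unfolding P_def q by blast
    moreover have "degree u = degree q" unfolding q by (rule degree_map_poly) simp
    ultimately show "degree f \<le> degree u" using min[of q] unfolding f(3) by simp
  qed
  obtain \<sigma> where "embedding_over_base \<sigma>" "\<sigma> y = b"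
    using R'(3) by (rule_tac pe_extends_to_embedding[OF R'(1)]) blast
  then show False using fixed \<open>b \<noteq> y\<close> by blast
qed

section \<open>Canonical rational coordinates of finitely many field elements\<close>

text \<open>\<open>l\<close> is the orthogonal projection of \<open>e\<close> to \<open>V\<close>
  for the standard form on the coordinates in \<open>R\<close>, which is positive definite over an
  ordered field. Induction on the coordinates: the vectors vanishing at the new one are handled by
  the hypothesis, and \<open>V\<close> exceeds them by at most one direction.\<close>

lemma orthogonal_decomposition:
  fixes V :: "('b \<Rightarrow> 'a::linordered_field) set"
  assumes "finite R"
    and "\<And>u v. u \<in> V \<Longrightarrow> v \<in> V \<Longrightarrow> (\<lambda>b. u b + v b) \<in> V"
    and "\<And>c v. v \<in> V \<Longrightarrow> (\<lambda>b. c * v b) \<in> V"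
    and "V \<noteq> {}"
  shows "\<exists>l\<in>V. \<forall>v\<in>V. (\<Sum>b\<in>R. v b * (e b - l b)) = 0"
  using assms
proof (induction R arbitrary: V e rule: finite_induct)
  case empty
  then show ?case by auto
next
  case (insert r R)
  define V' where "V' = {v \<in> V. v r = 0}"
  have V0: "(\<lambda>_. 0) \<in> V" using insert.prems(2)[of _ 0] insert.prems(3) by auto
  have sub: "(\<lambda>b. u b - c * v b) \<in> V" if "u \<in> V" "v \<in> V" for u v c
    using insert.prems(1)[OF that(1) insert.prems(2)[OF that(2), of "- c"]] by simp
  have V': "\<exists>l\<in>V'. \<forall>v\<in>V'. (\<Sum>b\<in>R. v b * (e b - l b)) = 0" for e
    by (rule insert.IH) (use insert.prems V0 in \<open>auto simp: V'_def\<close>)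
  have ins: "(\<Sum>b\<in>insert r R. h b) = h r + (\<Sum>b\<in>R. h b)" for h :: "'b \<Rightarrow> 'a"
    using insert.hyps by simp
  obtain l where l: "l \<in> V'" "\<And>v. v \<in> V' \<Longrightarrow> (\<Sum>b\<in>R. v b * (e b - l b)) = 0"
    using V'[of e] by blast
  show ?case
  proof (cases "V' = V")
    case True
    then show ?thesis using l V'_def by (intro bexI[of _ l]) (auto simp: ins)
  next
    case False
    then obtain u where u: "u \<in> V" "u r \<noteq> 0" by (auto simp: V'_def)
    obtain m where m: "m \<in> V'" "\<And>v. v \<in> V' \<Longrightarrow> (\<Sum>b\<in>R. v b * (u b - m b)) = 0"
      using V'[of u] by blast
    \<comment> \<open>Gram-Schmidt step: \<open>u0\<close> is orthogonal to \<open>V'\<close> and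
      not zero at \<open>r\<close>, so its square norm \<open>q\<close> is positive and the
      projection \<open>l\<close> to \<open>V'\<close> is corrected by a multiple of
      \<open>u0\<close>.\<close>
    define u0 where "u0 = (\<lambda>b. u b - m b)"
    have u0: "u0 \<in> V" "u0 r \<noteq> 0"
      using sub[of u m 1] u m(1) by (auto simp: u0_def V'_def)
    define q where "q = (\<Sum>b\<in>insert r R. u0 b * u0 b)"
    have "0 < u0 r * u0 r" using u0(2) by (metis not_square_less_zero linorder_neqE mult_eq_0_iff)
    moreover have "0 \<le> (\<Sum>b\<in>R. u0 b * u0 b)" by (intro sum_nonneg) simp
    ultimately have q: "q \<noteq> 0" unfolding q_def ins by linarith
    define c where "c = (\<Sum>b\<in>insert r R. u0 b * (e b - l b)) / q"
    define L where "L = (\<lambda>b. l b - (- c) * u0 b)"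
    have "L \<in> V" unfolding L_def using sub[of l u0 "- c"] l(1) u0(1) by (simp add: V'_def)
    moreover have "(\<Sum>b\<in>insert r R. v b * (e b - L b)) = 0" if "v \<in> V" for v
    proof -
      \<comment> \<open>The multiple of \<open>u0\<close> that makes \<open>v' = v - k u0\<close>
        vanish at \<open>r\<close>, so that \<open>v\<close> splits along \<open>V'\<close> and the
        line of \<open>u0\<close>.\<close>
      define k where "k = v r / u0 r"
      define v' where "v' = (\<lambda>b. v b - k * u0 b)"
      have v': "v' \<in> V'" using sub[OF that u0(1), of k] u0(2) by (auto simp: V'_def v'_def k_def)
      have "(\<Sum>b\<in>insert r R. v b * (e b - L b))
          = (\<Sum>b\<in>insert r R. v' b * (e b - l b)) - c * (\<Sum>b\<in>insert r R. v' b * u0 b)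
            + k * ((\<Sum>b\<in>insert r R. u0 b * (e b - l b)) - c * q)"
        unfolding q_def sum_distrib_left sum_subtractf[symmetric] sum.distrib[symmetric]
        by (intro sum.cong refl) (simp add: v'_def L_def algebra_simps)
      also have "(\<Sum>b\<in>insert r R. v' b * (e b - l b)) = 0"
        using l(2)[OF v'] v' by (simp add: ins V'_def)
      also have "(\<Sum>b\<in>insert r R. v' b * u0 b) = 0"
        using m(2)[OF v'] v' by (simp add: ins V'_def u0_def)
      also have "(\<Sum>b\<in>insert r R. u0 b * (e b - l b)) = c * q" using q by (simp add: c_def)
      finally show ?thesis by simp
    qed
    ultimately show ?thesis by blast
  qed
qed

lemma common_denominator:
  fixes f :: "'b \<Rightarrow> rat"
  assumes "finite S"
  shows "\<exists>N::nat. N > 0 \<and> (\<forall>s\<in>S. \<exists>k::int. of_nat N * f s = of_int k)"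
  using assms
proof (induction S rule: finite_induct)
  case empty
  then show ?case by (intro exI[of _ 1]) auto
next
  case (insert s S)
  then obtain N :: nat where N: "N > 0" "\<forall>s\<in>S. \<exists>k::int. of_nat N * f s = of_int k" by blast
  obtain p q :: int where "q > 0" and fs: "f s = of_int p / of_int q" by (metis quotient_of_denom_pos quotient_of_div surj_pair)
  have "\<exists>k::int. of_nat (N * nat q) * f t = of_int k" if "t \<in> insert s S" for t
  proof (cases "t = s")
    case True
    have "of_nat (N * nat q) * f t = of_nat N * (of_int q * (of_int p / of_int q))"
      using \<open>q > 0\<close> unfolding True fs of_nat_mult by (simp only: of_nat_nat less_imp_le mult.assoc)
    also have "\<dots> = of_int (int N * p)" using \<open>q > 0\<close> by simp
    finally show ?thesis ..
  next
    case False
    then have "t \<in> S" using that by simp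
    then obtain k :: int where k: "of_nat N * f t = of_int k" using bspec[OF N(2)] by metis
    have "of_int q * (of_nat N * f t) = of_int (q * k)" unfolding k by simp
    then have "of_nat (N * nat q) * f t = of_int (q * k)"
      using \<open>q > 0\<close> unfolding of_nat_mult by (simp only: of_nat_nat less_imp_le mult_ac)
    then show ?thesis ..
  qed
  then show ?case using N(1) \<open>q > 0\<close> by (intro exI[of _ "N * nat q"]) auto
qed

text \<open>Every \<open>\<alpha> \<in> R\<close> has a unique rational representation \<open>\<alpha> = (\<Sum>\<beta>\<in>R. w \<beta> * \<beta>)\<close> orthogonal to all
  rational relations between the elements of \<open>R\<close>.  Uniqueness makes \<open>w\<close> additive in \<open>\<alpha>\<close> and
  equivariant; \<open>C \<alpha> \<beta>\<close> is \<open>w \<beta>\<close> with denominators cleared.\<close>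

lemma canonical_integral_coordinates:
  fixes R :: "'l::field_char_0 set"
  assumes R: "finite R"
  obtains C :: "'l \<Rightarrow> 'l \<Rightarrow> int" and N :: nat
  where "N > 0"
    and "\<And>\<alpha>. \<alpha> \<in> R \<Longrightarrow> (\<Sum>\<beta>\<in>R. of_int (C \<alpha> \<beta>) * \<beta>) = of_nat N * \<alpha>"
    and "\<And>(I :: nat set) x \<beta>. finite I \<Longrightarrow> (\<And>i. i \<in> I \<Longrightarrow> x i \<in> R) \<Longrightarrow> sum x I \<in> R \<Longrightarrow> \<beta> \<in> R \<Longrightarrow>
          C (sum x I) \<beta> = (\<Sum>i\<in>I. C (x i) \<beta>)"
    and "\<And>\<sigma> \<alpha> \<beta>. inj \<sigma> \<Longrightarrow> \<sigma> ` R \<subseteq> R \<Longrightarrow> (\<And>a b. \<sigma> (a + b) = \<sigma> a + \<sigma> b) \<Longrightarrow>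
          (\<And>r a. \<sigma> (of_rat r * a) = of_rat r * \<sigma> a) \<Longrightarrow> \<alpha> \<in> R \<Longrightarrow> \<beta> \<in> R \<Longrightarrow> C (\<sigma> \<alpha>) (\<sigma> \<beta>) = C \<alpha> \<beta>"
proof -
  \<comment> \<open>The rational linear relations between the elements of \<open>R\<close>.\<close>
  define V where "V = {v :: 'l \<Rightarrow> rat. (\<Sum>\<beta>\<in>R. of_rat (v \<beta>) * \<beta>) = 0}"
  define rep where "rep \<alpha> w \<longleftrightarrow> (\<Sum>\<beta>\<in>R. of_rat (w \<beta>) * \<beta>) = \<alpha> \<and> (\<forall>v\<in>V. (\<Sum>\<beta>\<in>R. v \<beta> * w \<beta>) = 0)"
    for \<alpha> and w :: "'l \<Rightarrow> rat"
  have ex: "\<exists>w. rep \<alpha> w" if "\<alpha> \<in> R" for \<alpha>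
  proof -
    \<comment> \<open>The trivial representation of \<alpha>. Subtracting its projection to
      \<open>V\<close> removes a relation, so the result still represents \<alpha> and is orthogonal
      to \<open>V\<close>.\<close>
    define e where "e \<beta> = (if \<beta> = \<alpha> then 1 else 0 :: rat)" for \<beta>
    have "\<exists>l\<in>V. \<forall>v\<in>V. (\<Sum>b\<in>R. v b * (e b - l b)) = 0"
    proof (rule orthogonal_decomposition[OF R])
      show "V \<noteq> {}" by (auto simp: V_def intro!: exI[of _ "\<lambda>_. 0"])
    next
      fix c v assume "v \<in> V"
      then have "of_rat c * (\<Sum>\<beta>\<in>R. of_rat (v \<beta>) * \<beta>) = 0" by (simp add: V_def)
      then show "(\<lambda>b. c * v b) \<in> V" by (simp add: V_def of_rat_mult mult.assoc sum_distrib_left)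
    qed (simp add: V_def of_rat_add distrib_right sum.distrib)
    then obtain l where l: "l \<in> V" "\<forall>v\<in>V. (\<Sum>b\<in>R. v b * (e b - l b)) = 0" by blast
    have "(\<Sum>\<beta>\<in>R. of_rat (e \<beta> - l \<beta>) * \<beta>) = (\<Sum>\<beta>\<in>R. of_rat (e \<beta>) * \<beta>)"
      using l(1) by (simp add: of_rat_diff left_diff_distrib sum_subtractf V_def)
    also have "\<dots> = (\<Sum>\<beta>\<in>R. if \<beta> = \<alpha> then \<alpha> else 0)" by (intro sum.cong) (auto simp: e_def)
    also have "\<dots> = \<alpha>" using R that by simp
    finally show ?thesis using l(2) by (intro exI[of _ "\<lambda>b. e b - l b"]) (simp add: rep_def)
  qed
  have uniq: "w \<beta> = w' \<beta>" if "rep \<alpha> w" "rep \<alpha> w'" "\<beta> \<in> R" for \<alpha> w w' \<beta>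
  proof -
    \<comment> \<open>The difference of two representations is a relation and is orthogonal to all
      relations, in particular to itself; a vanishing sum of rational squares has only zero
      terms.\<close>
    define u where "u \<beta> = w \<beta> - w' \<beta>" for \<beta>
    have uV: "u \<in> V"
      using that by (simp add: u_def V_def rep_def of_rat_diff left_diff_distrib sum_subtractf)
    have "(\<Sum>\<beta>\<in>R. u \<beta> * u \<beta>) = (\<Sum>\<beta>\<in>R. u \<beta> * w \<beta>) - (\<Sum>\<beta>\<in>R. u \<beta> * w' \<beta>)"
      by (simp add: u_def right_diff_distrib sum_subtractf)
    also have "\<dots> = 0" using that uV by (simp add: rep_def)
    finally have "\<forall>\<beta>\<in>R. u \<beta> * u \<beta> = 0" using R by (subst (asm) sum_nonneg_eq_0_iff) auto
    then show ?thesis using that(3) by (simp add: u_def)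
  qed
  obtain w where w: "rep \<alpha> (w \<alpha>)" if "\<alpha> \<in> R" for \<alpha> using ex by metis
  obtain N :: nat where N: "N > 0"
    "\<forall>p\<in>R \<times> R. \<exists>k::int. of_nat N * (case p of (\<alpha>, \<beta>) \<Rightarrow> w \<alpha> \<beta>) = of_int k"
    using common_denominator[of "R \<times> R" "\<lambda>(\<alpha>, \<beta>). w \<alpha> \<beta>"] R by blast
  \<comment> \<open>For arguments in \<open>R\<close> the number under the floor is already an
    integer.\<close>
  define C where "C \<alpha> \<beta> = \<lfloor>of_nat N * w \<alpha> \<beta>\<rfloor>" for \<alpha> \<beta>
  have C: "of_int (C \<alpha> \<beta>) = of_nat N * w \<alpha> \<beta>" if "\<alpha> \<in> R" "\<beta> \<in> R" for \<alpha> \<beta>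
  proof -
    have "\<exists>k::int. of_nat N * w \<alpha> \<beta> = of_int k"
      using bspec[OF N(2), of "(\<alpha>, \<beta>)"] that by simp
    then obtain k :: int where "of_nat N * w \<alpha> \<beta> = of_int k" ..
    then show ?thesis by (simp add: C_def)
  qed
  show ?thesis
  proof (rule that[of N C])
    show "N > 0" by fact
  next
    fix \<alpha> assume a: "\<alpha> \<in> R"
    have "(\<Sum>\<beta>\<in>R. of_int (C \<alpha> \<beta>) * \<beta>) = (\<Sum>\<beta>\<in>R. of_rat (of_int (C \<alpha> \<beta>)) * \<beta>)" by simp
    also have "\<dots> = of_nat N * (\<Sum>\<beta>\<in>R. of_rat (w \<alpha> \<beta>) * \<beta>)"
      unfolding sum_distrib_left by (intro sum.cong) (simp_all add: C a of_rat_mult)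
    finally show "(\<Sum>\<beta>\<in>R. of_int (C \<alpha> \<beta>) * \<beta>) = of_nat N * \<alpha>" using w[OF a] by (simp add: rep_def)
  next
    fix I :: "nat set" and x \<beta>
    assume I: "finite I" "\<And>i. i \<in> I \<Longrightarrow> x i \<in> R" "sum x I \<in> R" "\<beta> \<in> R"
    define u where "u \<beta> = (\<Sum>i\<in>I. w (x i) \<beta>)" for \<beta>
    have "(\<Sum>\<beta>\<in>R. of_rat (u \<beta>) * \<beta>) = (\<Sum>i\<in>I. \<Sum>\<beta>\<in>R. of_rat (w (x i) \<beta>) * \<beta>)"
      by (subst sum.swap) (simp add: u_def of_rat_sum sum_distrib_right)
    also have "\<dots> = sum x I" using w I(2) by (intro sum.cong) (auto simp: rep_def)
    finally have 1: "(\<Sum>\<beta>\<in>R. of_rat (u \<beta>) * \<beta>) = sum x I" .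
    have 2: "(\<Sum>\<beta>\<in>R. v \<beta> * u \<beta>) = 0" if "v \<in> V" for v
    proof -
      have "(\<Sum>\<beta>\<in>R. v \<beta> * u \<beta>) = (\<Sum>i\<in>I. \<Sum>\<beta>\<in>R. v \<beta> * w (x i) \<beta>)"
        by (subst sum.swap) (simp add: u_def sum_distrib_left)
      also have "\<dots> = 0" using w I(2) that by (intro sum.neutral) (auto simp: rep_def)
      finally show ?thesis .
    qed
    have "w (sum x I) \<beta> = u \<beta>" by (rule uniq[OF w[OF I(3)] _ I(4)]) (simp add: rep_def 1 2)
    then have "(of_int (C (sum x I) \<beta>) :: rat) = of_int (\<Sum>i\<in>I. C (x i) \<beta>)"
      using I by (simp add: C u_def sum_distrib_left)
    then show "C (sum x I) \<beta> = (\<Sum>i\<in>I. C (x i) \<beta>)" unfolding of_int_eq_iff .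
  next
    fix \<sigma> \<alpha> \<beta>
    assume inj: "inj \<sigma>" and im: "\<sigma> ` R \<subseteq> R" and add: "\<And>a b. \<sigma> (a + b) = \<sigma> a + \<sigma> b"
      and scl: "\<And>r a. \<sigma> (of_rat r * a) = of_rat r * \<sigma> a" and ab: "\<alpha> \<in> R" "\<beta> \<in> R"
    have z: "\<sigma> 0 = 0" using add[of 0 0] by simp
    have sm: "\<sigma> (sum h S) = (\<Sum>b\<in>S. \<sigma> (h b))" for h and S :: "'l set"
      by (induction S rule: infinite_finite_induct) (auto simp: z add)
    have bij: "bij_betw \<sigma> R R"
      unfolding bij_betw_def using endo_inj_surj[OF R im] inj by (metis inj_on_subset subset_UNIV)
    have \<sigma>\<alpha>: "\<sigma> \<alpha> \<in> R" "\<sigma> \<beta> \<in> R" using im ab by auto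
    define u where "u \<beta> = w (\<sigma> \<alpha>) (\<sigma> \<beta>)" for \<beta>
    have "\<sigma> (\<Sum>\<beta>\<in>R. of_rat (u \<beta>) * \<beta>) = (\<Sum>\<beta>\<in>R. of_rat (w (\<sigma> \<alpha>) (\<sigma> \<beta>)) * \<sigma> \<beta>)"
      by (simp add: sm scl u_def)
    also have "\<dots> = (\<Sum>\<beta>\<in>R. of_rat (w (\<sigma> \<alpha>) \<beta>) * \<beta>)" by (rule sum.reindex_bij_betw[OF bij])
    also have "\<dots> = \<sigma> \<alpha>" using w[OF \<sigma>\<alpha>(1)] by (simp add: rep_def)
    finally have 1: "(\<Sum>\<beta>\<in>R. of_rat (u \<beta>) * \<beta>) = \<alpha>" using inj by (simp add: inj_eq)
    have 2: "(\<Sum>\<beta>\<in>R. v \<beta> * u \<beta>) = 0" if "v \<in> V" for v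
    proof -
      \<comment> \<open>The relation \<open>v\<close> transported along \<sigma>; orthogonality of
        the coordinates of \<open>\<sigma> \<alpha>\<close> to \<open>v'\<close> is orthogonality of
        the pulled-back \<open>u\<close> to \<open>v\<close>.\<close>
      define v' where "v' = v \<circ> inv_into UNIV \<sigma>"
      have v': "v' (\<sigma> \<beta>) = v \<beta>" for \<beta> using inj by (simp add: v'_def)
      have "(\<Sum>\<beta>\<in>R. of_rat (v' \<beta>) * \<beta>) = (\<Sum>\<beta>\<in>R. of_rat (v' (\<sigma> \<beta>)) * \<sigma> \<beta>)"
        by (rule sum.reindex_bij_betw[OF bij, symmetric])
      also have "\<dots> = \<sigma> (\<Sum>\<beta>\<in>R. of_rat (v \<beta>) * \<beta>)" by (simp add: v' sm scl)
      also have "\<dots> = 0" using that z by (simp add: V_def)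
      finally have "v' \<in> V" by (simp add: V_def)
      then have "0 = (\<Sum>\<beta>\<in>R. v' \<beta> * w (\<sigma> \<alpha>) \<beta>)" using w[OF \<sigma>\<alpha>(1)] by (simp add: rep_def)
      also have "\<dots> = (\<Sum>\<beta>\<in>R. v' (\<sigma> \<beta>) * w (\<sigma> \<alpha>) (\<sigma> \<beta>))"
        by (rule sum.reindex_bij_betw[OF bij, symmetric])
      finally show ?thesis by (simp add: v' u_def)
    qed
    have "w \<alpha> \<beta> = u \<beta>" by (rule uniq[OF w[OF ab(1)] _ ab(2)]) (simp add: rep_def 1 2)
    then show "C (\<sigma> \<alpha>) (\<sigma> \<beta>) = C \<alpha> \<beta>" by (simp add: C_def u_def)
  qed
qed

section \<open>Generalized eigenspaces\<close>

locale vector_space_operators = vector_space scale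
  for scale :: "'a::field_char_0 \<Rightarrow> 'b::ab_group_add \<Rightarrow> 'b"
begin

abbreviation endo :: "('b \<Rightarrow> 'b) \<Rightarrow> bool" where "endo \<equiv> Vector_Spaces.linear scale scale"

lemma lin_iff: "endo f \<longleftrightarrow> (\<forall>x y. f (x + y) = f x + f y) \<and> (\<forall>c x. f (scale c x) = scale c (f x))"
  unfolding Vector_Spaces.linear_iff using vector_space_axioms by blast

lemma lin_add: "endo f \<Longrightarrow> f (x + y) = f x + f y"
  and lin_scale: "endo f \<Longrightarrow> f (scale c x) = scale c (f x)"
  by (auto simp: lin_iff)

lemma lin_zero: "endo f \<Longrightarrow> f 0 = 0"
  using lin_scale[of f 0 0] by simp

lemma lin_diff: "endo f \<Longrightarrow> f (x - y) = f x - f y"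
  using lin_add[of f "x - y" y] by (simp add: algebra_simps)

lemma lin_sum: "endo f \<Longrightarrow> f (sum h S) = (\<Sum>s\<in>S. f (h s))"
  by (induction S rule: infinite_finite_induct) (auto simp: lin_zero lin_add)

lemma lin_funpow: "endo f \<Longrightarrow> endo (f ^^ k)"
  by (induction k) (auto simp: lin_iff)

lemma funpow_zero_mono: "endo f \<Longrightarrow> (f ^^ k) x = 0 \<Longrightarrow> k \<le> m \<Longrightarrow> (f ^^ m) x = 0"
  using funpow_add[of "m - k" k f] by (simp add: lin_zero lin_funpow)

text \<open>The geometric series for the inverse of \<open>f + c\<close>, in recursive form: if
  \<open>w\<close> solves the equation for \<open>f y\<close>, which is killed by one power less,
  then \<open>(y - w) / c\<close> solves it for \<open>y\<close>.\<close>

lemma nilpotent_plus_scalar_surj: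
  assumes "endo f" "c \<noteq> 0" "(f ^^ k) y = 0"
  shows "\<exists>z. (f ^^ k) z = 0 \<and> f z + scale c z = y"
  using assms(3)
proof (induction k arbitrary: y)
  case 0
  then show ?case using assms(1) by (auto intro!: exI[of _ 0] simp: lin_zero)
next
  case (Suc k)
  then have "(f ^^ k) (f y) = 0" by (simp add: funpow_swap1)
  with Suc.IH obtain w where w: "(f ^^ k) w = 0" "f w + scale c w = f y" by blast
  define z where "z = scale (inverse c) (y - w)"
  have "(f ^^ Suc k) w = 0" using w(1) assms(1) by (simp add: lin_zero)
  then have "(f ^^ Suc k) z = 0"
    using Suc.prems lin_funpow[OF assms(1), of "Suc k"] by (simp only: z_def lin_scale lin_diff) simp
  moreover have "f z = scale (inverse c) (scale c w)"
    using w(2) by (simp add: z_def lin_scale[OF assms(1)] lin_diff[OF assms(1)] algebra_simps flip: w(2))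
  then have "f z + scale c z = y" using assms(2) by (simp add: z_def)
  ultimately show ?case by blast
qed

lemma nilpotent_plus_scalar_inj:
  assumes "endo f" "c \<noteq> 0" "(f ^^ k) y = 0" "f y + scale c y = 0"
  shows "y = 0"
  using assms(3)
proof (induction k)
  case (Suc k)
  have "f y = scale (- c) y" using assms(4) by (simp add: eq_neg_iff_add_eq_0)
  then have "(f ^^ Suc k) y = scale (- c) ((f ^^ k) y)"
    by (simp add: funpow_swap1 lin_scale[OF lin_funpow[OF assms(1)]] del: scale_minus_left)
  then show ?case using Suc assms(2) by simp
qed simp

definition shift :: "('b \<Rightarrow> 'b) \<Rightarrow> 'a \<Rightarrow> 'b \<Rightarrow> 'b" where
  "shift d \<alpha> x = d x - scale \<alpha> x"

definition gen_eigenspace :: "('b \<Rightarrow> 'b) \<Rightarrow> 'a \<Rightarrow> 'b set" where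
  "gen_eigenspace d \<alpha> = {x. \<exists>k. (shift d \<alpha> ^^ k) x = 0}"

definition exp_trunc :: "('b \<Rightarrow> 'b) \<Rightarrow> 'a \<Rightarrow> nat \<Rightarrow> 'b \<Rightarrow> 'b" where
  "exp_trunc f c N x = (\<Sum>k<N. scale (c ^ k * inverse (fact k)) ((f ^^ k) x))"

lemma lin_exp_trunc: "endo f \<Longrightarrow> endo (exp_trunc f c N)"
  unfolding lin_iff[of "exp_trunc f c N"] exp_trunc_def
  by (simp add: lin_add lin_scale lin_funpow scale_right_distrib sum.distrib scale_sum_right mult.commute)

lemma exp_trunc_extend:
  assumes "endo f" "(f ^^ N) x = 0" "N \<le> M"
  shows "exp_trunc f c M x = exp_trunc f c N x"
  unfolding exp_trunc_def
  by (rule sum.mono_neutral_right) (use assms funpow_zero_mono[OF assms(1,2)] in auto)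

text \<open>Downward induction: if all powers of \<open>f\<close> above the \<open>j\<close>-th kill
  \<open>x\<close>, then applying \<open>f ^^ j\<close> to the exponential leaves only the term
  \<open>(f ^^ j) x\<close>, which must vanish. At \<open>j = 0\<close> this is
  \<open>x\<close>.\<close>

lemma exp_trunc_inj:
  assumes f: "endo f" and x: "(f ^^ N) x = 0" and e: "exp_trunc f c N x = 0"
  shows "x = 0"
proof -
  have "(f ^^ j) x = 0" if "j \<le> N" for j
    using that
  proof (induction rule: inc_induct)
    case base
    show ?case by (rule x)
  next
    case (step j)
    have "0 = (f ^^ j) (exp_trunc f c N x)" using e lin_zero[OF lin_funpow[OF f]] by simp
    also have "\<dots> = (\<Sum>k<N. scale (c ^ k * inverse (fact k)) ((f ^^ (j + k)) x))"
      unfolding exp_trunc_def by (simp add: lin_sum lin_scale lin_funpow f funpow_add)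
    also have "\<dots> = (\<Sum>k<N. if k = 0 then (f ^^ j) x else 0)"
    proof (rule sum.cong)
      fix k assume "k \<in> {..<N}"
      show "scale (c ^ k * inverse (fact k)) ((f ^^ (j + k)) x) = (if k = 0 then (f ^^ j) x else 0)"
        using funpow_zero_mono[OF f step.IH, of "j + k"] by auto
    qed simp
    also have "\<dots> = (f ^^ j) x" using step.hyps by simp
    finally show ?case by simp
  qed
  from this[of 0] show ?thesis by simp
qed

context
  fixes d
  assumes d: "endo d"
begin

lemma lin_shift: "endo (shift d \<alpha>)"
  using d by (auto simp: lin_iff shift_def algebra_simps scale_left_commute)

lemma shift_commute: "shift d \<alpha> (shift d \<beta> x) = shift d \<beta> (shift d \<alpha> x)"
  by (simp add: shift_def lin_diff[OF d] lin_scale[OF d] algebra_simps)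

lemma shift_funpow_commute: "shift d \<alpha> ((shift d \<beta> ^^ k) x) = (shift d \<beta> ^^ k) (shift d \<alpha> x)"
  by (induction k) (simp_all add: shift_commute[of \<alpha> \<beta>])

lemma shift_change: "shift d \<beta> x = shift d \<alpha> x + scale (\<alpha> - \<beta>) x"
  by (simp add: shift_def algebra_simps)

lemma subspace_gen_eigenspace: "subspace (gen_eigenspace d \<alpha>)"
proof (rule subspaceI)
  show "0 \<in> gen_eigenspace d \<alpha>" by (auto simp: gen_eigenspace_def intro: exI[of _ 0])
next
  fix x y assume "x \<in> gen_eigenspace d \<alpha>" "y \<in> gen_eigenspace d \<alpha>"
  then obtain k m where "(shift d \<alpha> ^^ k) x = 0" "(shift d \<alpha> ^^ m) y = 0"
    by (auto simp: gen_eigenspace_def)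
  then have "(shift d \<alpha> ^^ (max k m)) (x + y) = 0"
    using funpow_zero_mono[OF lin_shift, of k _ x "max k m"] funpow_zero_mono[OF lin_shift, of m _ y "max k m"]
    by (simp add: lin_add[OF lin_funpow[OF lin_shift]])
  then show "x + y \<in> gen_eigenspace d \<alpha>" unfolding gen_eigenspace_def by blast
next
  fix c x assume "x \<in> gen_eigenspace d \<alpha>"
  then show "scale c x \<in> gen_eigenspace d \<alpha>"
    by (auto simp: gen_eigenspace_def lin_scale[OF lin_funpow[OF lin_shift]] intro!: exI)
qed

lemma shift_in_gen_eigenspace: "x \<in> gen_eigenspace d \<alpha> \<Longrightarrow> shift d \<beta> x \<in> gen_eigenspace d \<alpha>"
  unfolding gen_eigenspace_def
  by (auto simp flip: shift_funpow_commute) (metis lin_zero[OF lin_shift])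

lemma shift_inD: "shift d \<alpha> x \<in> gen_eigenspace d \<alpha> \<Longrightarrow> x \<in> gen_eigenspace d \<alpha>"
  unfolding gen_eigenspace_def by (auto simp: funpow_swap1[symmetric] intro: exI[of _ "Suc _"])

lemma funpow_shift_in_gen_eigenspace: "x \<in> gen_eigenspace d \<alpha> \<Longrightarrow> (shift d \<beta> ^^ k) x \<in> gen_eigenspace d \<alpha>"
  by (induction k) (auto intro: shift_in_gen_eigenspace)

lemma shift_inj_on_gen_eigenspace:
  assumes "x \<in> gen_eigenspace d \<alpha>" "shift d \<beta> x = 0" "\<alpha> \<noteq> \<beta>" shows "x = 0"
proof -
  obtain k where "(shift d \<alpha> ^^ k) x = 0" using assms(1) by (auto simp: gen_eigenspace_def)
  then show ?thesis
    using nilpotent_plus_scalar_inj[OF lin_shift, of "\<alpha> - \<beta>" k \<alpha> x] assms(2,3) by (simp add: shift_change[of \<beta> x \<alpha>])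
qed

lemma shift_surj_on_gen_eigenspace:
  assumes "y \<in> gen_eigenspace d \<alpha>" "\<alpha> \<noteq> \<beta>"
  obtains z where "z \<in> gen_eigenspace d \<alpha>" "shift d \<beta> z = y"
proof -
  obtain k where "(shift d \<alpha> ^^ k) y = 0" using assms(1) by (auto simp: gen_eigenspace_def)
  then show ?thesis
    using nilpotent_plus_scalar_surj[OF lin_shift, of "\<alpha> - \<beta>" k \<alpha> y] assms(2) that
    by (auto simp: shift_change[of \<beta> _ \<alpha>] gen_eigenspace_def)
qed

text \<open>A power of \<open>d - \<beta>\<close> removes the summand at \<beta>, keeps the others
  in their spaces and is injective there, so induction applies to the remaining sum.\<close>

lemma gen_eigenspaces_independent:
  assumes "finite S" "\<And>\<alpha>. \<alpha> \<in> S \<Longrightarrow> f \<alpha> \<in> gen_eigenspace d \<alpha>" "sum f S = 0" "\<alpha> \<in> S"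
  shows "f \<alpha> = 0"
  using assms
proof (induction S arbitrary: f \<alpha> rule: finite_induct)
  case (insert \<beta> S)
  obtain k where k: "(shift d \<beta> ^^ k) (f \<beta>) = 0" using insert.prems(1)[of \<beta>] by (auto simp: gen_eigenspace_def)
  have z: "f \<gamma> = 0" if "\<gamma> \<in> S" for \<gamma>
  proof -
    have "(\<Sum>\<gamma>\<in>S. (shift d \<beta> ^^ k) (f \<gamma>)) = (shift d \<beta> ^^ k) (sum f (insert \<beta> S))"
      using insert.hyps k by (simp add: lin_add lin_sum lin_funpow lin_shift)
    also have "\<dots> = 0" using insert.prems(2) by (simp add: lin_zero lin_funpow lin_shift)
    finally have "(shift d \<beta> ^^ k) (f \<gamma>) = 0"
      by (rule insert.IH[rotated]) (use that insert.prems(1) in \<open>auto intro: funpow_shift_in_gen_eigenspace\<close>)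
    moreover have "\<gamma> \<noteq> \<beta>" using that insert.hyps by blast
    moreover have "x = 0" if "x \<in> gen_eigenspace d \<gamma>" "(shift d \<beta> ^^ j) x = 0" "\<gamma> \<noteq> \<beta>" for x j
      using that
      by (induction j) (auto dest: shift_inj_on_gen_eigenspace[OF funpow_shift_in_gen_eigenspace])
    ultimately show ?thesis using insert.prems(1) \<open>\<gamma> \<in> S\<close> by blast
  qed
  then show ?case using insert.prems(2,3) insert.hyps by auto
qed simp

section \<open>Spaces annihilated by a product of linear factors in the operator\<close>

lemma foldr_shift_commute: "foldr (shift d) l (shift d \<alpha> x) = shift d \<alpha> (foldr (shift d) l x)"
  by (induction l) (simp_all add: shift_commute)

lemma lin_foldr_shift: "endo (foldr (shift d) l)"
proof (induction l)
  case Nil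
  then show ?case by (simp add: lin_iff)
next
  case (Cons a l)
  then show ?case using lin_shift[of a] by (simp add: lin_iff)
qed

definition poly_act :: "'a poly \<Rightarrow> 'b \<Rightarrow> 'b" where
  "poly_act p x = (\<Sum>i\<le>degree p. scale (coeff p i) ((d ^^ i) x))"

lemma poly_act_eq: "degree p \<le> N \<Longrightarrow> poly_act p x = (\<Sum>i\<le>N. scale (coeff p i) ((d ^^ i) x))"
  unfolding poly_act_def by (rule sum.mono_neutral_left) (auto simp: coeff_eq_0)

lemma poly_act_linear_factor: "poly_act ([:- \<alpha>, 1:] * p) x = shift d \<alpha> (poly_act p x)"
proof -
  define N where "N = degree p"
  have c: "coeff ([:- \<alpha>, 1:] * p) i = (case i of 0 \<Rightarrow> 0 | Suc j \<Rightarrow> coeff p j) - \<alpha> * coeff p i" for i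
    by (auto simp: coeff_pCons split: nat.split)
  have "poly_act ([:- \<alpha>, 1:] * p) x = (\<Sum>i\<le>Suc N. scale (coeff ([:- \<alpha>, 1:] * p) i) ((d ^^ i) x))"
    by (rule poly_act_eq) (use degree_mult_le[of "[:- \<alpha>, 1:]" p] in \<open>simp add: N_def\<close>)
  also have "\<dots> = (\<Sum>i\<le>Suc N. scale (case i of 0 \<Rightarrow> 0 | Suc j \<Rightarrow> coeff p j) ((d ^^ i) x))
      - scale \<alpha> (\<Sum>i\<le>Suc N. scale (coeff p i) ((d ^^ i) x))"
    unfolding c scale_sum_right by (simp only: scale_left_diff_distrib sum_subtractf scale_scale)
  also have "(\<Sum>i\<le>Suc N. scale (coeff p i) ((d ^^ i) x)) = poly_act p x"
    by (rule poly_act_eq[symmetric]) (simp add: N_def)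
  also have "(\<Sum>i\<le>Suc N. scale (case i of 0 \<Rightarrow> 0 | Suc j \<Rightarrow> coeff p j) ((d ^^ i) x)) = d (poly_act p x)"
    by (subst sum.atMost_Suc_shift) (simp add: poly_act_def N_def lin_sum lin_scale d)
  finally show ?thesis by (simp add: shift_def)
qed

lemma poly_act_split: "poly_act (\<Prod>\<alpha>\<leftarrow>l. [:- \<alpha>, 1:]) x = foldr (shift d) l x"
  by (induction l) (simp_all only: list.map prod_list.Cons prod_list.Nil poly_act_linear_factor foldr.simps o_def,
    simp_all add: poly_act_def)

lemma foldr_shift_swap: "foldr (shift d) l (foldr (shift d) m x) = foldr (shift d) m (foldr (shift d) l x)"
  by (induction m) (simp_all add: foldr_shift_commute)

lemma foldr_shift_concat:
  assumes "m \<in> set ls" "foldr (shift d) m x = 0"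
  shows "foldr (shift d) (concat ls) x = 0"
  using assms(1)
proof (induction ls)
  case (Cons m' ls)
  then show ?case
    using assms(2) foldr_shift_swap[of m' "concat ls" x] lin_zero[OF lin_foldr_shift] by auto
qed simp

text \<open>Decompose \<open>(d - \<alpha>) x\<close> by induction and divide its components at the
  values other than \<alpha> by \<open>d - \<alpha>\<close>, which is surjective there. After
  subtracting these quotients from \<open>x\<close>, what is left is mapped by
  \<open>d - \<alpha>\<close> into the space of \<alpha>, so it lies there itself.\<close>

lemma foldr_shift_decomp:
  assumes "foldr (shift d) l x = 0"
  shows "\<exists>f. (\<forall>\<alpha>\<in>set l. f \<alpha> \<in> gen_eigenspace d \<alpha>) \<and> x = sum f (set l)"
  using assms
proof (induction l arbitrary: x)
  case (Cons \<alpha> l)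
  have "foldr (shift d) l (shift d \<alpha> x) = 0" using Cons.prems by (simp add: foldr_shift_commute)
  then obtain f where f: "\<And>\<beta>. \<beta> \<in> set l \<Longrightarrow> f \<beta> \<in> gen_eigenspace d \<beta>" "shift d \<alpha> x = sum f (set l)"
    using Cons.IH by blast
  have "\<exists>z. z \<in> gen_eigenspace d \<beta> \<and> shift d \<alpha> z = f \<beta>" if "\<beta> \<in> set l - {\<alpha>}" for \<beta>
    using that f(1) shift_surj_on_gen_eigenspace[of "f \<beta>" \<beta> \<alpha>] by blast
  then obtain z where z: "\<And>\<beta>. \<beta> \<in> set l - {\<alpha>} \<Longrightarrow> z \<beta> \<in> gen_eigenspace d \<beta>"
    "\<And>\<beta>. \<beta> \<in> set l - {\<alpha>} \<Longrightarrow> shift d \<alpha> (z \<beta>) = f \<beta>" by metis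
  define y where "y = x - sum z (set l - {\<alpha>})"
  have "shift d \<alpha> y = sum f (set l) - sum f (set l - {\<alpha>})"
    using z(2) by (simp add: y_def lin_diff lin_sum lin_shift f(2))
  also have "\<dots> \<in> gen_eigenspace d \<alpha>"
    using f(1)[of \<alpha>] subspace_0[OF subspace_gen_eigenspace] by (cases "\<alpha> \<in> set l") (auto simp: sum_diff1)
  finally have y: "y \<in> gen_eigenspace d \<alpha>" by (rule shift_inD)
  have "x = (\<Sum>\<beta>\<in>insert \<alpha> (set l - {\<alpha>}). if \<beta> = \<alpha> then y else z \<beta>)"
    by (subst sum.insert) (auto simp: y_def intro!: sum.cong)
  also have "insert \<alpha> (set l - {\<alpha>}) = set (\<alpha> # l)" by auto
  finally show ?case
    using y z(1) by (intro exI[of _ "\<lambda>\<beta>. if \<beta> = \<alpha> then y else z \<beta>"]) auto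
qed simp

lemma foldr_shift_nilpotency:
  assumes "foldr (shift d) l x = 0" "x \<in> gen_eigenspace d \<alpha>"
  shows "(shift d \<alpha> ^^ length l) x = 0"
  using assms
proof (induction l arbitrary: x)
  case (Cons \<beta> l)
  have in_gen: "foldr (shift d) l x \<in> gen_eigenspace d \<alpha>"
    using Cons.prems(2) by (induction l) (auto intro: shift_in_gen_eigenspace)
  show ?case
  proof (cases "\<alpha> = \<beta>")
    case True
    then have "(shift d \<alpha> ^^ length l) (shift d \<alpha> x) = 0"
      using Cons.prems by (intro Cons.IH) (auto simp: foldr_shift_commute intro: shift_in_gen_eigenspace)
    then show ?thesis by (simp add: funpow_swap1)
  next
    case False
    then have "foldr (shift d) l x = 0" using Cons.prems(1) in_gen by (auto dest: shift_inj_on_gen_eigenspace)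
    then show ?thesis using Cons lin_zero[OF lin_shift] by simp
  qed
qed simp

lemma gen_eigenspace_trivial:
  assumes "foldr (shift d) l x = 0" "x \<in> gen_eigenspace d \<alpha>" "\<alpha> \<notin> set l"
  shows "x = 0"
  using assms
proof (induction l)
  case (Cons \<beta> l)
  have in_gen: "foldr (shift d) l x \<in> gen_eigenspace d \<alpha>"
    using Cons.prems(2) by (induction l) (auto intro: shift_in_gen_eigenspace)
  then have "foldr (shift d) l x = 0" using Cons.prems by (auto dest: shift_inj_on_gen_eigenspace)
  then show ?case using Cons by simp
qed simp

end

end

text \<open>The annihilating list replaces finite dimension: the extended space to which this is
  applied consists of all functions on a type and is in general infinite-dimensional.\<close>

locale split_operator = vector_space_operators scale
  for scale :: "'k::field_char_0 \<Rightarrow> 'v::ab_group_add \<Rightarrow> 'v" +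
  fixes d :: "'v \<Rightarrow> 'v" and l :: "'k list"
  assumes lin_d: "endo d" and kill: "foldr (shift d) l x = 0"
begin

abbreviation "gen \<equiv> gen_eigenspace d"

text \<open>The true spectrum rather than \<open>set l\<close>, which may contain further values:
  only the former is guaranteed to be mapped into itself by the embeddings.\<close>

definition spec :: "'k set" where "spec = {\<alpha>. gen \<alpha> \<noteq> {0}}"

lemma zero_in_gen: "0 \<in> gen \<alpha>"
  by (rule subspace_0[OF subspace_gen_eigenspace[OF lin_d]])

lemma notin_spec: "\<alpha> \<notin> spec \<Longrightarrow> x \<in> gen \<alpha> \<Longrightarrow> x = 0"
  by (auto simp: spec_def)

lemma spec_subset: "spec \<subseteq> set l"
  using gen_eigenspace_trivial[OF lin_d kill] zero_in_gen by (force simp: spec_def)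

lemma finite_spec: "finite spec"
  using spec_subset finite_subset by blast

lemma gen_nilpotency: "x \<in> gen \<alpha> \<Longrightarrow> (shift d \<alpha> ^^ length l) x = 0"
  by (rule foldr_shift_nilpotency[OF lin_d kill])

definition component :: "'v \<Rightarrow> 'k \<Rightarrow> 'v" where
  "component x = (SOME f. (\<forall>\<alpha>. f \<alpha> \<in> gen \<alpha>) \<and> x = sum f spec)"

lemma component: "component x \<alpha> \<in> gen \<alpha>" "sum (component x) spec = x"
proof -
  obtain f where f: "\<And>\<alpha>. \<alpha> \<in> set l \<Longrightarrow> f \<alpha> \<in> gen \<alpha>" "x = sum f (set l)"
    using foldr_shift_decomp[OF lin_d kill] by blast
  have "x = sum f spec"
    unfolding f(2) using f(1) notin_spec by (intro sum.mono_neutral_right spec_subset) auto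
  then have "x = (\<Sum>\<alpha>\<in>spec. if \<alpha> \<in> set l then f \<alpha> else 0)"
    using spec_subset by (simp add: subset_iff cong: sum.cong)
  then have "\<exists>f. (\<forall>\<alpha>. f \<alpha> \<in> gen \<alpha>) \<and> x = sum f spec"
    using f(1) zero_in_gen by (intro exI[of _ "\<lambda>\<alpha>. if \<alpha> \<in> set l then f \<alpha> else 0"]) auto
  from someI_ex[OF this] show "component x \<alpha> \<in> gen \<alpha>" "sum (component x) spec = x"
    by (auto simp: component_def)
qed

lemma component_unique:
  assumes f: "\<And>\<alpha>. \<alpha> \<in> spec \<Longrightarrow> f \<alpha> \<in> gen \<alpha>" "x = sum f spec"
  shows "\<alpha> \<in> spec \<Longrightarrow> component x \<alpha> = f \<alpha>"
  using gen_eigenspaces_independent[OF lin_d finite_spec, of "\<lambda>\<alpha>. component x \<alpha> - f \<alpha>"]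
  by (simp add: component f(1) f(2)[symmetric] sum_subtractf subspace_diff[OF subspace_gen_eigenspace[OF lin_d]])

text \<open>By nilpotency of \<open>d - \<alpha>\<close> on the generalized eigenspace of \<open>\<alpha>\<close>, the series truncated at
  \<open>length l\<close> is the full exponential.\<close>

definition spectral_exp :: "('k \<Rightarrow> 'k) \<Rightarrow> 'k \<Rightarrow> 'v \<Rightarrow> 'v" where
  "spectral_exp g c x = (\<Sum>\<alpha>\<in>spec. scale (g \<alpha>) (exp_trunc (shift d \<alpha>) c (length l) (component x \<alpha>)))"

lemma spectral_exp_sum:
  assumes f: "\<And>\<alpha>. \<alpha> \<in> spec \<Longrightarrow> f \<alpha> \<in> gen \<alpha>"
  shows "spectral_exp g c (sum f spec)
    = (\<Sum>\<alpha>\<in>spec. scale (g \<alpha>) (exp_trunc (shift d \<alpha>) c (length l) (f \<alpha>)))"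
  unfolding spectral_exp_def using component_unique[OF f refl] by (intro sum.cong refl) simp

text \<open>\<open>component\<close> is only a choice; linearity comes from uniqueness, since sums
  and multiples of components decompose the sum and the multiple.\<close>

lemma lin_spectral_exp: "endo (spectral_exp g c)"
proof -
  have 1: "spectral_exp g c (x + y) = spectral_exp g c x + spectral_exp g c y" for x y
  proof -
    have "x + y = (\<Sum>\<alpha>\<in>spec. component x \<alpha> + component y \<alpha>)" by (simp add: sum.distrib component)
    then have "spectral_exp g c (x + y) = (\<Sum>\<alpha>\<in>spec. scale (g \<alpha>)
        (exp_trunc (shift d \<alpha>) c (length l) (component x \<alpha> + component y \<alpha>)))"
      using spectral_exp_sum[of "\<lambda>\<alpha>. component x \<alpha> + component y \<alpha>"] component(1)
      by (simp add: subspace_add[OF subspace_gen_eigenspace[OF lin_d]])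
    then show ?thesis
      by (simp add: lin_add lin_exp_trunc lin_shift lin_d scale_right_distrib sum.distrib spectral_exp_def)
  qed
  have 2: "spectral_exp g c (scale k x) = scale k (spectral_exp g c x)" for k x
  proof -
    have "scale k x = (\<Sum>\<alpha>\<in>spec. scale k (component x \<alpha>))" by (simp add: component flip: scale_sum_right)
    then have "spectral_exp g c (scale k x) = (\<Sum>\<alpha>\<in>spec. scale (g \<alpha>)
        (exp_trunc (shift d \<alpha>) c (length l) (scale k (component x \<alpha>))))"
      using spectral_exp_sum[of "\<lambda>\<alpha>. scale k (component x \<alpha>)"] component(1)
      by (simp add: subspace_scale[OF subspace_gen_eigenspace[OF lin_d]])
    then show ?thesis
      by (simp add: lin_scale lin_exp_trunc lin_shift lin_d scale_sum_right spectral_exp_def mult.commute)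
  qed
  show ?thesis using 1 2 by (simp add: lin_iff)
qed

lemma spectral_exp_gen:
  assumes "x \<in> gen \<alpha>"
  shows "spectral_exp g c x = scale (g \<alpha>) (exp_trunc (shift d \<alpha>) c (length l) x)"
proof (cases "\<alpha> \<in> spec")
  case True
  define f where "f \<beta> = (if \<beta> = \<alpha> then x else 0)" for \<beta>
  have x: "x = sum f spec" using True finite_spec by (simp add: f_def)
  have "spectral_exp g c x = (\<Sum>\<beta>\<in>spec. scale (g \<beta>) (exp_trunc (shift d \<beta>) c (length l) (f \<beta>)))"
    by (subst x, rule spectral_exp_sum) (use assms zero_in_gen in \<open>auto simp: f_def\<close>)
  also have "\<dots> = (\<Sum>\<beta>\<in>spec. if \<beta> = \<alpha> then scale (g \<alpha>) (exp_trunc (shift d \<alpha>) c (length l) x) else 0)"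
    by (intro sum.cong refl) (auto simp: f_def lin_zero lin_exp_trunc lin_shift lin_d)
  also have "\<dots> = scale (g \<alpha>) (exp_trunc (shift d \<alpha>) c (length l) x)" using True finite_spec by simp
  finally show ?thesis .
next
  case False
  then show ?thesis
    using notin_spec[OF _ assms] by (simp add: lin_zero lin_spectral_exp lin_exp_trunc lin_shift lin_d)
qed

lemma exp_trunc_in_gen: "x \<in> gen \<alpha> \<Longrightarrow> exp_trunc (shift d \<alpha>) c N x \<in> gen \<alpha>"
  unfolding exp_trunc_def
  by (intro subspace_sum subspace_scale subspace_gen_eigenspace lin_d funpow_shift_in_gen_eigenspace)

lemma spectral_exp_in_gen: "x \<in> gen \<alpha> \<Longrightarrow> spectral_exp g c x \<in> gen \<alpha>"
  by (simp add: spectral_exp_gen exp_trunc_in_gen subspace_scale[OF subspace_gen_eigenspace[OF lin_d]])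

lemma spectral_exp_inj:
  assumes g: "\<And>\<alpha>. \<alpha> \<in> spec \<Longrightarrow> g \<alpha> \<noteq> 0" and x: "spectral_exp g c x = 0"
  shows "x = 0"
proof -
  have "component x \<alpha> = 0" if "\<alpha> \<in> spec" for \<alpha>
  proof -
    have "scale (g \<alpha>) (exp_trunc (shift d \<alpha>) c (length l) (component x \<alpha>)) = 0"
      by (rule gen_eigenspaces_independent[OF lin_d finite_spec _ x[unfolded spectral_exp_def] that])
        (simp add: component exp_trunc_in_gen subspace_scale[OF subspace_gen_eigenspace[OF lin_d]])
    then have "exp_trunc (shift d \<alpha>) c (length l) (component x \<alpha>) = 0" using g[OF that] by simp
    then show ?thesis by (rule exp_trunc_inj[OF lin_shift[OF lin_d] gen_nilpotency[OF component(1)]])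
  qed
  then show ?thesis using component(2)[of x] by simp
qed

context
  fixes \<tau> :: "'v \<Rightarrow> 'v" and \<sigma> :: "'k \<Rightarrow> 'k"
  assumes add: "\<And>x y. \<tau> (x + y) = \<tau> x + \<tau> y" and scl: "\<And>k x. \<tau> (scale k x) = scale (\<sigma> k) (\<tau> x)"
    and \<tau>d: "\<And>x. \<tau> (d x) = d (\<tau> x)"
begin

lemma semilinear_zero: "\<tau> 0 = 0"
  using add[of 0 0] by simp

lemma semilinear_sum: "\<tau> (sum h S) = (\<Sum>s\<in>S. \<tau> (h s))"
  by (induction S rule: infinite_finite_induct) (auto simp: semilinear_zero add)

lemma semilinear_shift_funpow: "\<tau> ((shift d \<alpha> ^^ k) y) = (shift d (\<sigma> \<alpha>) ^^ k) (\<tau> y)"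
proof -
  have "\<tau> (u - v) = \<tau> u - \<tau> v" for u v using add[of "u - v" v] by (simp add: algebra_simps)
  then show ?thesis by (induction k) (simp_all add: shift_def \<tau>d scl)
qed

lemma semilinear_gen:
  assumes "y \<in> gen \<alpha>" shows "\<tau> y \<in> gen (\<sigma> \<alpha>)"
proof -
  obtain k where "(shift d \<alpha> ^^ k) y = 0" using assms by (auto simp: gen_eigenspace_def)
  then have "(shift d (\<sigma> \<alpha>) ^^ k) (\<tau> y) = 0"
    by (simp add: semilinear_zero flip: semilinear_shift_funpow)
  then show ?thesis by (auto simp: gen_eigenspace_def)
qed

lemma semilinear_spec:
  assumes "inj \<tau>" shows "\<sigma> ` spec \<subseteq> spec"
proof clarify
  fix \<alpha> assume "\<alpha> \<in> spec"
  then obtain y where "y \<in> gen \<alpha>" "y \<noteq> 0" using zero_in_gen by (force simp: spec_def)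
  then show "\<sigma> \<alpha> \<in> spec"
    using notin_spec semilinear_gen inj_eq[OF assms, of y 0] semilinear_zero by metis
qed

text \<open>\<tau> moves the space of \<alpha> to that of \<open>\<sigma> \<alpha>\<close> and
  intertwines the shifts. It is applied to embeddings acting on coefficients, and, with \<sigma> the
  identity, to the restriction of functions to the basis.\<close>

lemma spectral_exp_equivariant:
  assumes \<sigma>: "\<And>k m. \<sigma> (k * m) = \<sigma> k * \<sigma> m" "\<And>k. \<sigma> (inverse (fact k)) = inverse (fact k)" "\<sigma> 1 = 1"
    and g: "\<And>\<alpha>. \<alpha> \<in> spec \<Longrightarrow> g (\<sigma> \<alpha>) = \<sigma> (g \<alpha>)" and c: "\<sigma> c = c"
  shows "\<tau> (spectral_exp g c x) = spectral_exp g c (\<tau> x)"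
proof -
  have \<sigma>p: "\<sigma> (c ^ k) = c ^ k" for k by (induction k) (simp_all add: \<sigma> c)
  have ex: "\<tau> (exp_trunc (shift d \<alpha>) c N y) = exp_trunc (shift d (\<sigma> \<alpha>)) c N (\<tau> y)" for \<alpha> N y
    by (simp add: exp_trunc_def semilinear_sum scl semilinear_shift_funpow \<sigma> \<sigma>p)
  have "\<tau> (spectral_exp g c x) = (\<Sum>\<alpha>\<in>spec. spectral_exp g c (\<tau> (component x \<alpha>)))"
    unfolding spectral_exp_def[of g c x] semilinear_sum
    by (intro sum.cong refl) (simp add: spectral_exp_gen[OF semilinear_gen[OF component(1)]] scl ex g)
  also have "\<dots> = spectral_exp g c (\<tau> (sum (component x) spec))"
    by (simp add: lin_sum[OF lin_spectral_exp] semilinear_sum)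
  finally show ?thesis by (simp add: component)
qed

end

end

section \<open>Algebras with an \<open>n\<close>-ary multiplication\<close>

locale n_ary_algebra = vector_space_operators scale
  for scale :: "'k::field_char_0 \<Rightarrow> 'v::ab_group_add \<Rightarrow> 'v" +
  fixes n :: nat and br :: "(nat \<Rightarrow> 'v) \<Rightarrow> 'v"
  assumes br_cong: "(\<And>i. i \<in> {1..n} \<Longrightarrow> x i = y i) \<Longrightarrow> br x = br y"
    and lin_br: "i \<in> {1..n} \<Longrightarrow> endo (\<lambda>v. br (x(i := v)))"
begin

lemma br_sum: "i \<in> {1..n} \<Longrightarrow> br (x(i := sum f S)) = (\<Sum>j\<in>S. br (x(i := f j)))"
  using lin_sum[OF lin_br] .

lemma br_scale: "i \<in> {1..n} \<Longrightarrow> br (x(i := scale c v)) = scale c (br (x(i := v)))"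
  using lin_scale[OF lin_br] .

lemma br_diff: "i \<in> {1..n} \<Longrightarrow> br (x(i := v - w)) = br (x(i := v)) - br (x(i := w))"
  using lin_diff[OF lin_br] .

lemma br_zero:
  assumes "i \<in> {1..n}" "x i = 0" shows "br x = 0"
  using lin_zero[OF lin_br[OF assms(1), of x]] assms(2) by (metis fun_upd_triv)

text \<open>Multilinear expansion one position at a time; \<open>I\<close> is the set of positions
  treated so far, which makes the induction possible.\<close>

lemma br_sum_on:
  assumes "finite S" "I \<subseteq> {1..n}"
  shows "br (\<lambda>i. if i \<in> I then sum (f i) S else x i)
    = (\<Sum>\<kappa>\<in>I \<rightarrow>\<^sub>E S. br (\<lambda>i. if i \<in> I then f i (\<kappa> i) else x i))"
proof -
  have "finite I" using assms(2) finite_subset by blast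
  then show ?thesis using assms(2)
  proof (induction I arbitrary: x rule: finite_induct)
    case (insert i I)
    have "br (\<lambda>k. if k \<in> insert i I then sum (f k) S else x k)
        = br ((\<lambda>k. if k \<in> I then sum (f k) S else x k)(i := sum (f i) S))"
      by (rule br_cong) auto
    also have "\<dots> = (\<Sum>j\<in>S. br ((\<lambda>k. if k \<in> I then sum (f k) S else x k)(i := f i j)))"
      using insert.prems by (simp add: br_sum)
    also have "\<dots> = (\<Sum>j\<in>S. br (\<lambda>k. if k \<in> I then sum (f k) S else (x(i := f i j)) k))"
      using insert.hyps by (intro sum.cong refl br_cong) auto
    also have "\<dots> = (\<Sum>j\<in>S. \<Sum>\<kappa>\<in>I \<rightarrow>\<^sub>E S. br (\<lambda>k. if k \<in> I then f k (\<kappa> k) else (x(i := f i j)) k))"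
      using insert by simp
    also have "\<dots> = (\<Sum>(j, \<kappa>)\<in>S \<times> (I \<rightarrow>\<^sub>E S). br (\<lambda>k. if k \<in> I then f k (\<kappa> k) else (x(i := f i j)) k))"
      by (rule sum.cartesian_product)
    also have "\<dots> = (\<Sum>\<kappa>\<in>insert i I \<rightarrow>\<^sub>E S. br (\<lambda>k. if k \<in> insert i I then f k (\<kappa> k) else x k))"
      unfolding PiE_insert_eq using insert.hyps
      by (subst sum.reindex[OF inj_combinator]) (auto intro!: sum.cong br_cong)
    finally show ?case .
  qed simp
qed

lemma br_sum_all:
  assumes "finite S"
  shows "br (\<lambda>i. sum (f i) S) = (\<Sum>\<kappa>\<in>{1..n} \<rightarrow>\<^sub>E S. br (\<lambda>i. f i (\<kappa> i)))"
proof -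
  have "br (\<lambda>i. sum (f i) S) = br (\<lambda>i. if i \<in> {1..n} then sum (f i) S else 0)" by (rule br_cong) simp
  also have "\<dots> = (\<Sum>\<kappa>\<in>{1..n} \<rightarrow>\<^sub>E S. br (\<lambda>i. if i \<in> {1..n} then f i (\<kappa> i) else 0))"
    by (rule br_sum_on[OF assms]) simp
  also have "\<dots> = (\<Sum>\<kappa>\<in>{1..n} \<rightarrow>\<^sub>E S. br (\<lambda>i. f i (\<kappa> i)))"
    by (intro sum.cong refl br_cong) simp
  finally show ?thesis .
qed

lemma br_scale_on:
  assumes "I \<subseteq> {1..n}"
  shows "br (\<lambda>i. if i \<in> I then scale (c i) (f i) else f i) = scale (\<Prod>i\<in>I. c i) (br f)"
proof -
  have "finite I" using assms finite_subset by blast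
  then show ?thesis using assms
  proof (induction I rule: finite_induct)
    case (insert i I)
    have "br (\<lambda>k. if k \<in> insert i I then scale (c k) (f k) else f k)
        = br ((\<lambda>k. if k \<in> I then scale (c k) (f k) else f k)(i := scale (c i) (f i)))"
      by (rule br_cong) auto
    also have "\<dots> = scale (c i) (br ((\<lambda>k. if k \<in> I then scale (c k) (f k) else f k)(i := f i)))"
      using insert.prems by (simp add: br_scale)
    also have "(\<lambda>k. if k \<in> I then scale (c k) (f k) else f k)(i := f i)
        = (\<lambda>k. if k \<in> I then scale (c k) (f k) else f k)"
      using insert.hyps by auto
    finally show ?case using insert by simp
  qed simp
qed

lemma br_scale_all: "br (\<lambda>i. scale (c i) (f i)) = scale (\<Prod>i\<in>{1..n}. c i) (br f)"
  using br_scale_on[of "{1..n}" c f] br_cong[of "\<lambda>i. scale (c i) (f i)" "\<lambda>i. if i \<in> {1..n} then scale (c i) (f i) else f i"]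
  by simp

text \<open>The operator may vary with the position: subtracting \<alpha>_i in slot i amounts to
  subtracting the sum of the \<alpha>_i outside.\<close>

definition leibniz_rule :: "('v \<Rightarrow> 'v) \<Rightarrow> (nat \<Rightarrow> 'v \<Rightarrow> 'v) \<Rightarrow> bool" where
  "leibniz_rule T T' \<longleftrightarrow> (\<forall>x. T (br x) = (\<Sum>i\<in>{1..n}. br (x(i := T' i (x i)))))"

context
  fixes T T'
  assumes T: "endo T" and T': "\<And>i. endo (T' i)" and rule: "leibniz_rule T T'"
begin

text \<open>Each application of \<open>T\<close> lowers the exponent still allowed in one slot. Once
  some exponent is 0, that entry is 0 and so is the bracket; a total of 0 forces this because there
  is at least one slot.\<close>

lemma leibniz_nilpotent:
  assumes "n \<ge> 1" "\<And>i. i \<in> {1..n} \<Longrightarrow> (T' i ^^ k i) (x i) = 0"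
  shows "(T ^^ (\<Sum>i\<in>{1..n}. k i)) (br x) = 0"
  using assms(2)
proof (induction "\<Sum>i\<in>{1..n}. k i" arbitrary: k x)
  case 0
  then have "k 1 = 0" using assms(1) by simp
  then have "x 1 = 0" using 0(2)[of 1] assms(1) by simp
  then show ?case using br_zero[of 1 x] assms(1) by (simp add: lin_zero lin_funpow T)
next
  case (Suc m)
  show ?case
  proof (cases "\<exists>i\<in>{1..n}. k i = 0")
    case True
    then obtain i where "i \<in> {1..n}" "x i = 0" using Suc.prems by (metis funpow_0)
    then show ?thesis using br_zero by (simp add: lin_zero lin_funpow T)
  next
    case False
    have "(T ^^ m) (br (x(i := T' i (x i)))) = 0" if i: "i \<in> {1..n}" for i
    proof -
      define k' where "k' = k(i := k i - 1)"
      have ki: "k i = Suc (k i - 1)" using False i by auto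
      have "(\<Sum>i\<in>{1..n}. k i) = Suc (\<Sum>i\<in>{1..n}. k' i)"
        using sum.remove[OF _ i, of k] sum.remove[OF _ i, of k'] ki
        by (simp add: k'_def)
      then have m: "m = (\<Sum>i\<in>{1..n}. k' i)" using Suc.hyps(2) by simp
      show ?thesis
        unfolding m
      proof (rule Suc.hyps(1)[OF m])
        fix j assume j: "j \<in> {1..n}"
        have "(T' i ^^ (k i - 1)) (T' i (x i)) = 0"
          using Suc.prems[OF i] ki by (metis comp_apply funpow_Suc_right)
        then show "(T' j ^^ k' j) ((x(i := T' i (x i))) j) = 0" using Suc.prems[OF j] by (simp add: k'_def)
      qed
    qed
    then show ?thesis
      using rule unfolding Suc.hyps(2)[symmetric]
      by (simp add: funpow_swap1 leibniz_rule_def lin_sum lin_funpow T del: One_nat_def)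
  qed
qed

text \<open>Weak compositions of \<open>k\<close> into \<open>n\<close> parts, taken extensional so
  that each is counted once; the bound on the parts makes finiteness evident.\<close>

definition compositions :: "nat \<Rightarrow> (nat \<Rightarrow> nat) set" where
  "compositions k = {\<kappa> \<in> {1..n} \<rightarrow>\<^sub>E {..k}. (\<Sum>i\<in>{1..n}. \<kappa> i) = k}"

lemma compositions_iff: "\<kappa> \<in> compositions k \<longleftrightarrow> \<kappa> \<in> extensional {1..n} \<and> (\<Sum>i\<in>{1..n}. \<kappa> i) = k"
proof -
  have "\<kappa> i \<le> (\<Sum>i\<in>{1..n}. \<kappa> i)" if "i \<in> {1..n}" for i using that by (intro member_le_sum) auto
  then show ?thesis by (auto simp: compositions_def PiE_iff)
qed

lemma finite_compositions: "finite (compositions k)"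
  unfolding compositions_def by (intro finite_subset[OF _ finite_PiE[of "{1..n}" "\<lambda>_. {..k}"]]) auto

text \<open>Passing to divided powers removes the multinomial coefficients from the iterated Leibniz rule.\<close>

lemma leibniz_divided_power:
  "scale (inverse (fact k)) ((T ^^ k) (br x))
    = (\<Sum>\<kappa>\<in>compositions k. br (\<lambda>i. scale (inverse (fact (\<kappa> i))) ((T' i ^^ \<kappa> i) (x i))))"
proof (induction k)
  case 0
  have "compositions 0 = {\<lambda>i\<in>{1..n}. 0}"
    by (auto simp: compositions_iff extensional_def fun_eq_iff)
  moreover have "br x = br (\<lambda>i. scale (inverse (fact ((\<lambda>i\<in>{1..n}. 0) i))) ((T' i ^^ ((\<lambda>i\<in>{1..n}. 0) i)) (x i)))"
    by (rule br_cong) simp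
  ultimately show ?case by simp
next
  case (Suc k)
  define e where "e \<kappa> i = scale (inverse (fact (\<kappa> i))) ((T' i ^^ \<kappa> i) (x i))" for \<kappa> i
  have step: "br ((e \<kappa>)(i := T' i (e \<kappa> i))) = scale (of_nat (Suc (\<kappa> i))) (br (e (\<kappa>(i := Suc (\<kappa> i)))))"
    if "i \<in> {1..n}" for \<kappa> i
  proof -
    have "T' i (e \<kappa> i) = scale (of_nat (Suc (\<kappa> i))) (e (\<kappa>(i := Suc (\<kappa> i))) i)"
      by (simp add: e_def lin_scale T' field_simps del: of_nat_Suc)
    then have "br ((e \<kappa>)(i := T' i (e \<kappa> i)))
        = scale (of_nat (Suc (\<kappa> i))) (br ((e \<kappa>)(i := e (\<kappa>(i := Suc (\<kappa> i))) i)))"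
      using that by (simp only: br_scale)
    also have "br ((e \<kappa>)(i := e (\<kappa>(i := Suc (\<kappa> i))) i)) = br (e (\<kappa>(i := Suc (\<kappa> i))))"
      by (rule br_cong) (simp add: e_def)
    finally show ?thesis .
  qed
  \<comment> \<open>Both sides are compared after multiplication by k + 1, which is cancelled at the
    end.\<close>
  have "scale (of_nat (Suc k)) (scale (inverse (fact (Suc k))) ((T ^^ Suc k) (br x)))
      = T (scale (inverse (fact k)) ((T ^^ k) (br x)))"
    by (simp add: lin_scale T field_simps del: of_nat_Suc)
  also have "\<dots> = (\<Sum>\<kappa>\<in>compositions k. T (br (e \<kappa>)))"
    unfolding Suc.IH by (simp add: lin_sum T e_def[abs_def])
  also have "\<dots> = (\<Sum>\<kappa>\<in>compositions k. \<Sum>i\<in>{1..n}. scale (of_nat (Suc (\<kappa> i))) (br (e (\<kappa>(i := Suc (\<kappa> i))))))"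
    using rule by (intro sum.cong refl) (simp only: leibniz_rule_def step cong: sum.cong)
  also have "\<dots> = (\<Sum>(\<kappa>, i)\<in>compositions k \<times> {1..n}. scale (of_nat (Suc (\<kappa> i))) (br (e (\<kappa>(i := Suc (\<kappa> i))))))"
    by (rule sum.cartesian_product)
  \<comment> \<open>Raising slot i by one matches the pairs for k with those for k + 1 whose part at
    i is nonzero. Pairs with part 0 may then be added freely as their weight is 0, and for fixed
    \<kappa> the weights add up to k + 1.\<close>
  also have "\<dots> = (\<Sum>(\<kappa>, i)\<in>{(\<kappa>, i) \<in> compositions (Suc k) \<times> {1..n}. \<kappa> i \<noteq> 0}. scale (of_nat (\<kappa> i)) (br (e \<kappa>)))"
  proof (rule sum.reindex_bij_witness[of _ "\<lambda>(\<kappa>, i). (\<kappa>(i := \<kappa> i - 1), i)" "\<lambda>(\<kappa>, i). (\<kappa>(i := Suc (\<kappa> i)), i)"])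
    fix a assume a: "a \<in> compositions k \<times> {1..n}"
    obtain \<kappa> i where [simp]: "a = (\<kappa>, i)" by fastforce
    have i: "i \<in> {1..n}" using a by simp
    have "(\<Sum>j\<in>{1..n}. (\<kappa>(i := Suc (\<kappa> i))) j) = Suc (\<Sum>j\<in>{1..n}. \<kappa> j)"
      using sum.remove[OF _ i, of \<kappa>] sum.remove[OF _ i, of "\<kappa>(i := Suc (\<kappa> i))"] by simp
    then show "(case a of (\<kappa>, i) \<Rightarrow> (\<kappa>(i := Suc (\<kappa> i)), i)) \<in> {(\<kappa>, i) \<in> compositions (Suc k) \<times> {1..n}. \<kappa> i \<noteq> 0}"
      using a i by (auto simp: compositions_iff extensional_def)
  next
    fix b assume b: "b \<in> {(\<kappa>, i) \<in> compositions (Suc k) \<times> {1..n}. \<kappa> i \<noteq> 0}"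
    obtain \<kappa> i where [simp]: "b = (\<kappa>, i)" by fastforce
    have i: "i \<in> {1..n}" "\<kappa> i \<noteq> 0" using b by auto
    have "Suc (\<Sum>j\<in>{1..n}. (\<kappa>(i := \<kappa> i - 1)) j) = (\<Sum>j\<in>{1..n}. \<kappa> j)"
      using sum.remove[OF _ i(1), of \<kappa>] sum.remove[OF _ i(1), of "\<kappa>(i := \<kappa> i - 1)"] i(2) by simp
    then show "(case b of (\<kappa>, i) \<Rightarrow> (\<kappa>(i := \<kappa> i - 1), i)) \<in> compositions k \<times> {1..n}"
      using b i by (auto simp: compositions_iff extensional_def)
  qed (auto split: prod.splits)
  also have "\<dots> = (\<Sum>(\<kappa>, i)\<in>compositions (Suc k) \<times> {1..n}. scale (of_nat (\<kappa> i)) (br (e \<kappa>)))"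
    by (rule sum.mono_neutral_left) (auto simp: finite_compositions)
  also have "\<dots> = (\<Sum>\<kappa>\<in>compositions (Suc k). \<Sum>i\<in>{1..n}. scale (of_nat (\<kappa> i)) (br (e \<kappa>)))"
    by (rule sum.cartesian_product[symmetric])
  also have "\<dots> = (\<Sum>\<kappa>\<in>compositions (Suc k). scale (of_nat (Suc k)) (br (e \<kappa>)))"
    by (intro sum.cong refl) (simp add: compositions_iff flip: scale_sum_left of_nat_sum del: of_nat_Suc One_nat_def)
  also have "\<dots> = scale (of_nat (Suc k)) (\<Sum>\<kappa>\<in>compositions (Suc k). br (e \<kappa>))"
    by (simp only: scale_sum_right)
  finally show ?case by (simp only: scale_cancel_left of_nat_eq_0_iff e_def[abs_def]) simp
qed

text \<open>The product of the truncated exponentials runs over a box of exponents, the exponential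
  of the bracket over exponents of bounded total. Terms with some exponent at least \<open>N\<close>
  vanish, so both sums reduce to the box.\<close>

lemma exp_trunc_br:
  assumes nil: "\<And>i. i \<in> {1..n} \<Longrightarrow> (T' i ^^ N) (x i) = 0" and br_nil: "(T ^^ N) (br x) = 0"
  shows "exp_trunc T c N (br x) = br (\<lambda>i. exp_trunc (T' i) c N (x i))"
proof -
  define e where "e \<kappa> = br (\<lambda>i. scale (c ^ \<kappa> i * inverse (fact (\<kappa> i))) ((T' i ^^ \<kappa> i) (x i)))" for \<kappa>
  \<comment> \<open>Above \<open>n * N\<close>, so that the whole box is covered, and at least
    \<open>N\<close>, so that the truncation on the left can be raised to \<open>M\<close>.\<close>
  define M where "M = n * N + N + 1"
  have e0: "e \<kappa> = 0" if "i \<in> {1..n}" "N \<le> \<kappa> i" for \<kappa> i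
    unfolding e_def using br_zero[OF that(1)] funpow_zero_mono[OF T' nil[OF that(1)] that(2)] by simp
  have "exp_trunc T c N (br x) = exp_trunc T c M (br x)"
    using exp_trunc_extend[OF T br_nil, of M] by (simp add: M_def)
  also have "\<dots> = (\<Sum>k<M. scale (c ^ k) (scale (inverse (fact k)) ((T ^^ k) (br x))))"
    by (simp add: exp_trunc_def)
  also have "\<dots> = (\<Sum>k<M. \<Sum>\<kappa>\<in>compositions k. e \<kappa>)"
  proof (rule sum.cong[OF refl])
    fix k
    have "e \<kappa> = scale (c ^ k) (br (\<lambda>i. scale (inverse (fact (\<kappa> i))) ((T' i ^^ \<kappa> i) (x i))))"
      if "\<kappa> \<in> compositions k" for \<kappa>
    proof -
      have "e \<kappa> = br (\<lambda>i. scale (c ^ \<kappa> i) (scale (inverse (fact (\<kappa> i))) ((T' i ^^ \<kappa> i) (x i))))"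
        by (simp add: e_def)
      then show ?thesis unfolding br_scale_all using that by (simp add: compositions_iff flip: power_sum)
    qed
    then show "scale (c ^ k) (scale (inverse (fact k)) ((T ^^ k) (br x))) = (\<Sum>\<kappa>\<in>compositions k. e \<kappa>)"
      unfolding leibniz_divided_power scale_sum_right by (intro sum.cong refl) simp
  qed
  also have "\<dots> = sum e (\<Union>k<M. compositions k)"
    by (rule sum.UNION_disjoint[symmetric]) (auto simp: finite_compositions compositions_iff)
  also have "\<dots> = sum e ({1..n} \<rightarrow>\<^sub>E {..<N})"
  proof (rule sum.mono_neutral_right)
    show "finite (\<Union>k<M. compositions k)" by (simp add: finite_compositions)
    show "({1..n} \<rightarrow>\<^sub>E {..<N}) \<subseteq> (\<Union>k<M. compositions k)"
    proof
      fix \<kappa> assume k: "\<kappa> \<in> {1..n} \<rightarrow>\<^sub>E {..<N}"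
      then have "(\<Sum>i\<in>{1..n}. \<kappa> i) \<le> (\<Sum>i\<in>{1..n}. N)" by (intro sum_mono) (auto simp: PiE_iff less_imp_le)
      then show "\<kappa> \<in> (\<Union>k<M. compositions k)" using k by (auto simp: compositions_iff M_def PiE_iff)
    qed
    show "\<forall>\<kappa>\<in>(\<Union>k<M. compositions k) - ({1..n} \<rightarrow>\<^sub>E {..<N}). e \<kappa> = 0"
    proof
      fix \<kappa> assume "\<kappa> \<in> (\<Union>k<M. compositions k) - ({1..n} \<rightarrow>\<^sub>E {..<N})"
      then have "\<not> (\<forall>i\<in>{1..n}. \<kappa> i \<in> {..<N})"
        unfolding PiE_def Pi_iff by (simp only: UN_iff Diff_iff Int_iff mem_Collect_eq compositions_iff) blast
      then obtain i where "i \<in> {1..n}" "N \<le> \<kappa> i" by (metis lessThan_iff not_less)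
      then show "e \<kappa> = 0" by (rule e0)
    qed
  qed
  also have "\<dots> = br (\<lambda>i. exp_trunc (T' i) c N (x i))"
    by (simp add: exp_trunc_def br_sum_all e_def del: One_nat_def)
  finally show ?thesis .
qed

end

end

locale split_derivation = n_ary_algebra scale n br + split_operator scale d l
  for scale :: "'k::field_char_0 \<Rightarrow> 'v::ab_group_add \<Rightarrow> 'v" and n br d l +
  assumes n: "n \<ge> 1" and deriv: "leibniz_rule d (\<lambda>_. d)"
begin

lemma shift_leibniz: "leibniz_rule (shift d (\<Sum>i\<in>{1..n}. \<alpha> i)) (\<lambda>i. shift d (\<alpha> i))"
  unfolding leibniz_rule_def
proof
  fix x
  have "(\<Sum>i\<in>{1..n}. br (x(i := shift d (\<alpha> i) (x i))))
      = (\<Sum>i\<in>{1..n}. br (x(i := d (x i))) - scale (\<alpha> i) (br x))"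
    by (intro sum.cong refl) (simp add: shift_def br_diff br_scale)
  also have "\<dots> = shift d (\<Sum>i\<in>{1..n}. \<alpha> i) (br x)"
    using deriv by (simp add: leibniz_rule_def shift_def sum_subtractf scale_sum_left)
  finally show "shift d (\<Sum>i\<in>{1..n}. \<alpha> i) (br x) = (\<Sum>i\<in>{1..n}. br (x(i := shift d (\<alpha> i) (x i))))" ..
qed

lemma br_gen:
  assumes "\<And>i. i \<in> {1..n} \<Longrightarrow> x i \<in> gen (\<alpha> i)"
  shows "br x \<in> gen (\<Sum>i\<in>{1..n}. \<alpha> i)"
proof -
  have "(shift d (\<Sum>i\<in>{1..n}. \<alpha> i) ^^ (\<Sum>i\<in>{1..n}. length l)) (br x) = 0"
    by (rule leibniz_nilpotent[OF lin_shift[OF lin_d] lin_shift[OF lin_d] shift_leibniz n gen_nilpotency[OF assms]])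
  then show ?thesis unfolding gen_eigenspace_def by blast
qed

text \<open>The bracket lies in the space of the sum of the \<alpha>_i. If the sum is an eigenvalue,
  \<open>g\<close> is multiplicative on it; if not, that space is zero and both sides vanish, so
  nothing has to be demanded of \<open>g\<close> there.\<close>

lemma spectral_exp_br_gen:
  assumes g: "\<And>\<alpha>. (\<And>i. i \<in> {1..n} \<Longrightarrow> \<alpha> i \<in> spec) \<Longrightarrow> (\<Sum>i\<in>{1..n}. \<alpha> i) \<in> spec \<Longrightarrow>
      g (\<Sum>i\<in>{1..n}. \<alpha> i) = (\<Prod>i\<in>{1..n}. g (\<alpha> i))"
    and x: "\<And>i. i \<in> {1..n} \<Longrightarrow> x i \<in> gen (\<alpha> i)" and \<alpha>: "\<And>i. i \<in> {1..n} \<Longrightarrow> \<alpha> i \<in> spec"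
  shows "spectral_exp g c (br x) = br (\<lambda>i. spectral_exp g c (x i))"
proof (cases "(\<Sum>i\<in>{1..n}. \<alpha> i) \<in> spec")
  case True
  have "spectral_exp g c (br x)
      = scale (\<Prod>i\<in>{1..n}. g (\<alpha> i)) (exp_trunc (shift d (\<Sum>i\<in>{1..n}. \<alpha> i)) c (length l) (br x))"
    by (simp only: spectral_exp_gen[OF br_gen[OF x]] g[OF \<alpha> True])
  also have "\<dots> = scale (\<Prod>i\<in>{1..n}. g (\<alpha> i)) (br (\<lambda>i. exp_trunc (shift d (\<alpha> i)) c (length l) (x i)))"
    by (subst exp_trunc_br[OF lin_shift[OF lin_d] lin_shift[OF lin_d] shift_leibniz
          gen_nilpotency[OF x] gen_nilpotency[OF br_gen[OF x]]]) (assumption, rule refl)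
  also have "\<dots> = br (\<lambda>i. scale (g (\<alpha> i)) (exp_trunc (shift d (\<alpha> i)) c (length l) (x i)))"
    by (rule br_scale_all[symmetric])
  also have "\<dots> = br (\<lambda>i. spectral_exp g c (x i))"
    by (rule br_cong) (simp add: spectral_exp_gen[OF x])
  finally show ?thesis .
next
  case False
  have "br x = 0" by (rule notin_spec[OF False br_gen[OF x]])
  moreover have "br (\<lambda>i. spectral_exp g c (x i)) = 0"
    by (rule notin_spec[OF False br_gen[OF spectral_exp_in_gen[OF x]]])
  ultimately show ?thesis by (simp add: lin_zero lin_spectral_exp)
qed

lemma spectral_exp_br:
  assumes g: "\<And>\<alpha>. (\<And>i. i \<in> {1..n} \<Longrightarrow> \<alpha> i \<in> spec) \<Longrightarrow> (\<Sum>i\<in>{1..n}. \<alpha> i) \<in> spec \<Longrightarrow>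
      g (\<Sum>i\<in>{1..n}. \<alpha> i) = (\<Prod>i\<in>{1..n}. g (\<alpha> i))"
  shows "spectral_exp g c (br x) = br (\<lambda>i. spectral_exp g c (x i))"
proof -
  have "spectral_exp g c (br x) = spectral_exp g c (br (\<lambda>i. sum (component (x i)) spec))"
    by (simp add: component)
  also have "\<dots> = (\<Sum>\<kappa>\<in>{1..n} \<rightarrow>\<^sub>E spec. spectral_exp g c (br (\<lambda>i. component (x i) (\<kappa> i))))"
    by (simp add: br_sum_all[OF finite_spec] lin_sum[OF lin_spectral_exp] del: One_nat_def)
  also have "\<dots> = (\<Sum>\<kappa>\<in>{1..n} \<rightarrow>\<^sub>E spec. br (\<lambda>i. spectral_exp g c (component (x i) (\<kappa> i))))"
  proof (rule sum.cong[OF refl])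
    fix \<kappa> assume "\<kappa> \<in> {1..n} \<rightarrow>\<^sub>E spec"
    then show "spectral_exp g c (br (\<lambda>i. component (x i) (\<kappa> i))) = br (\<lambda>i. spectral_exp g c (component (x i) (\<kappa> i)))"
      by (intro spectral_exp_br_gen[of g _ \<kappa>] g) (auto simp: component)
  qed
  also have "\<dots> = br (\<lambda>i. \<Sum>\<alpha>\<in>spec. spectral_exp g c (component (x i) \<alpha>))"
    by (rule br_sum_all[OF finite_spec, symmetric])
  also have "\<dots> = br (\<lambda>i. spectral_exp g c (x i))"
    by (simp add: component flip: lin_sum[OF lin_spectral_exp])
  finally show ?thesis .
qed

end

section \<open>Scalar extension to the algebraic closure\<close>

lemma sum_fun_apply: "(\<Sum>s\<in>S. f s) b = (\<Sum>s\<in>S. f s b)"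
  for f :: "'a \<Rightarrow> 'b \<Rightarrow> 'c::comm_monoid_add"
proof (induction S rule: infinite_finite_induct)
  case (infinite S)
  then show ?case by (simp only: sum.infinite not_False_eq_True zero_fun_apply)
next
  case (insert x F)
  then show ?case by (simp only: sum.insert plus_fun_apply not_False_eq_True)
qed (simp only: sum.empty zero_fun_apply)

lemma to_ac_of_rat: "to_ac (of_rat r :: 'k::field_char_0) = of_rat r"
  by (cases r) (simp add: of_rat_rat)

context
  fixes \<sigma> :: "'k::field_char_0 alg_closure \<Rightarrow> 'k alg_closure"
  assumes \<sigma>: "embedding_over_base \<sigma>"
begin

lemma embedding_add: "\<sigma> (a + b) = \<sigma> a + \<sigma> b" and embedding_mult: "\<sigma> (a * b) = \<sigma> a * \<sigma> b"
  and embedding_to_ac: "\<sigma> (to_ac k) = to_ac k"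
  using \<sigma> unfolding embedding_over_base_def by blast+

lemma embedding_of_rat: "\<sigma> (of_rat r) = of_rat r"
  using embedding_to_ac[of "of_rat r"] by (simp only: to_ac_of_rat)

lemma embedding_0: "\<sigma> 0 = 0" and embedding_1: "\<sigma> 1 = 1" and embedding_of_nat: "\<sigma> (of_nat m) = of_nat m"
  using embedding_to_ac[of 0] embedding_to_ac[of 1] embedding_to_ac[of "of_nat m"] by simp_all

lemma embedding_uminus: "\<sigma> (- a) = - \<sigma> a"
proof -
  have "\<sigma> a + \<sigma> (- a) = 0" using embedding_add[of a "- a"] by (simp add: embedding_0)
  from minus_unique[OF this] show ?thesis ..
qed

lemma embedding_diff: "\<sigma> (a - b) = \<sigma> a - \<sigma> b"
  using embedding_add[of a "- b"] embedding_uminus by simp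

lemma embedding_inverse: "\<sigma> (inverse a) = inverse (\<sigma> a)"
proof (cases "a = 0")
  case False
  then have "\<sigma> a * \<sigma> (inverse a) = 1" by (simp add: embedding_1 flip: embedding_mult)
  from inverse_unique[OF this] show ?thesis ..
qed (simp add: embedding_0)

lemma embedding_eq_0_iff: "\<sigma> a = 0 \<longleftrightarrow> a = 0"
proof
  assume "\<sigma> a = 0"
  then have "\<sigma> (a * inverse a) = 0" by (simp add: embedding_mult)
  then show "a = 0" by (cases "a = 0") (simp_all add: embedding_1)
qed (simp add: embedding_0)

lemma inj_embedding: "inj \<sigma>"
proof (rule injI)
  fix a b assume "\<sigma> a = \<sigma> b"
  then have "\<sigma> (a - b) = 0" by (simp add: embedding_diff)
  then show "a = b" by (simp add: embedding_eq_0_iff)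
qed

lemma embedding_sum: "\<sigma> (sum f S) = (\<Sum>s\<in>S. \<sigma> (f s))"
  by (induction S rule: infinite_finite_induct) (auto simp: embedding_0 embedding_add)

lemma embedding_prod: "\<sigma> (prod f S) = (\<Prod>s\<in>S. \<sigma> (f s))"
  by (induction S rule: infinite_finite_induct) (auto simp: embedding_1 embedding_mult)

lemma embedding_power: "\<sigma> (a ^ k) = \<sigma> a ^ k"
  by (induction k) (auto simp: embedding_1 embedding_mult)

lemma embedding_power_int: "\<sigma> (a powi k) = \<sigma> a powi k"
  by (simp add: power_int_def embedding_power embedding_inverse)

lemma embedding_inverse_fact: "\<sigma> (inverse (fact k)) = inverse (fact k)"
  using embedding_of_nat[of "fact k"] by (simp add: embedding_inverse)

end

locale finite_dim_algebra = n_ary_algebra scale n br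
  for scale :: "'k::field_char_0 \<Rightarrow> 'v::ab_group_add \<Rightarrow> 'v" and n br +
  fixes Basis :: "'v set"
  assumes finite_Basis: "finite Basis" and indep_Basis: "independent Basis" and span_Basis: "span Basis = UNIV"
    and n: "n \<ge> 1"
begin

abbreviation "coord \<equiv> representation Basis"

lemma coord_add: "coord (x + y) b = coord x b + coord y b"
  and coord_scale: "coord (scale c x) b = c * coord x b"
  using span_Basis by (simp_all add: representation_add[OF indep_Basis] representation_scale[OF indep_Basis])

lemma coord_expand: "(\<Sum>b\<in>Basis. scale (coord x b) b) = x"
  using sum_representation_eq[OF indep_Basis _ finite_Basis] span_Basis by simp

lemma coord_notin: "b \<notin> Basis \<Longrightarrow> coord x b = 0"
  using representation_ne_zero by metis

lemma coord_basis: "a \<in> Basis \<Longrightarrow> coord a b = (if b = a then 1 else 0)"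
  by (simp add: representation_basis[OF indep_Basis])

text \<open>The extended space consists of all functions
  \<open>'v \<Rightarrow> 'k alg_closure\<close>, of which the operations below only read the values on the basis.\<close>

definition wscale :: "'k alg_closure \<Rightarrow> ('v \<Rightarrow> 'k alg_closure) \<Rightarrow> 'v \<Rightarrow> 'k alg_closure" where
  "wscale c u = (\<lambda>b. c * u b)"

definition coords :: "'v \<Rightarrow> 'v \<Rightarrow> 'k alg_closure" where
  "coords x = (\<lambda>b. to_ac (coord x b))"

definition ext_op :: "('v \<Rightarrow> 'v) \<Rightarrow> ('v \<Rightarrow> 'k alg_closure) \<Rightarrow> 'v \<Rightarrow> 'k alg_closure" where
  "ext_op f u = (\<Sum>a\<in>Basis. wscale (u a) (coords (f a)))"

definition ext_br :: "(nat \<Rightarrow> 'v \<Rightarrow> 'k alg_closure) \<Rightarrow> 'v \<Rightarrow> 'k alg_closure" where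
  "ext_br u = (\<Sum>\<tau>\<in>{1..n} \<rightarrow>\<^sub>E Basis. wscale (\<Prod>i\<in>{1..n}. u i (\<tau> i)) (coords (br \<tau>)))"

sublocale W: vector_space_operators wscale
  by unfold_locales (auto simp: wscale_def fun_eq_iff algebra_simps)

lemma coords_add: "coords (x + y) = coords x + coords y"
  and coords_scale: "coords (scale c x) = wscale (to_ac c) (coords x)"
  by (simp_all add: coords_def fun_eq_iff coord_add coord_scale wscale_def)

lemma coords_zero: "coords 0 = 0"
  by (simp add: coords_def representation_zero fun_eq_iff)

lemma coords_sum: "coords (sum f S) = (\<Sum>s\<in>S. coords (f s))"
  by (induction S rule: infinite_finite_induct) (auto simp: coords_zero coords_add)

lemma coords_inj: assumes "coords x = coords y" shows "x = y"
proof -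
  have "coord x b = coord y b" for b using fun_cong[OF assms, of b] by (simp only: coords_def to_ac_eq_iff)
  then have "(\<Sum>b\<in>Basis. scale (coord x b) b) = (\<Sum>b\<in>Basis. scale (coord y b) b)" by simp
  then show ?thesis by (simp only: coord_expand)
qed

lemma coords_sum_basis: "(\<Sum>a\<in>Basis. wscale (coords x a) (coords a)) = coords x"
proof -
  have "coords x = coords (\<Sum>a\<in>Basis. scale (coord x a) a)" by (simp only: coord_expand)
  also have "\<dots> = (\<Sum>a\<in>Basis. wscale (to_ac (coord x a)) (coords a))" by (simp only: coords_sum coords_scale)
  also have "\<dots> = (\<Sum>a\<in>Basis. wscale (coords x a) (coords a))" by (simp only: coords_def[of x])
  finally show ?thesis ..
qed

lemma basis_expand: "b \<in> Basis \<Longrightarrow> u b = (\<Sum>a\<in>Basis. wscale (u a) (coords a)) b"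
proof -
  assume b: "b \<in> Basis"
  have "(\<Sum>a\<in>Basis. wscale (u a) (coords a)) b = (\<Sum>a\<in>Basis. if a = b then u b else 0)"
    unfolding sum_fun_apply by (intro sum.cong refl) (auto simp: wscale_def coords_def coord_basis)
  then show ?thesis using b finite_Basis by simp
qed

lemma lin_ext_op: "W.endo (ext_op f)"
  unfolding W.lin_iff ext_op_def
proof safe
  fix u v show "(\<Sum>a\<in>Basis. wscale ((u + v) a) (coords (f a)))
    = (\<Sum>a\<in>Basis. wscale (u a) (coords (f a))) + (\<Sum>a\<in>Basis. wscale (v a) (coords (f a)))"
    by (simp add: W.scale_left_distrib sum.distrib)
next
  fix c u show "(\<Sum>a\<in>Basis. wscale (wscale c u a) (coords (f a))) = wscale c (\<Sum>a\<in>Basis. wscale (u a) (coords (f a)))"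
    unfolding W.scale_sum_right W.scale_scale by (simp only: wscale_def[of c u])
qed

lemma ext_op_coords:
  assumes "endo f" shows "ext_op f (coords x) = coords (f x)"
proof -
  have "coords (f x) = coords (f (\<Sum>b\<in>Basis. scale (coord x b) b))" by (simp add: coord_expand)
  then show ?thesis
    by (simp add: lin_sum[OF assms] lin_scale[OF assms] coords_sum coords_scale ext_op_def) (simp add: coords_def)
qed

lemma ext_br_cong: "(\<And>i b. i \<in> {1..n} \<Longrightarrow> b \<in> Basis \<Longrightarrow> u i b = v i b) \<Longrightarrow> ext_br u = ext_br v"
  unfolding ext_br_def
  by (intro sum.cong refl arg_cong2[where f = wscale] prod.cong) (auto simp: PiE_iff)

sublocale W: n_ary_algebra wscale n ext_br
proof (intro n_ary_algebra.intro n_ary_algebra_axioms.intro W.vector_space_operators_axioms)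
  fix u v :: "nat \<Rightarrow> 'v \<Rightarrow> 'k alg_closure"
  assume "\<And>i. i \<in> {1..n} \<Longrightarrow> u i = v i"
  then show "ext_br u = ext_br v" by (intro ext_br_cong) simp
next
  fix i and u :: "nat \<Rightarrow> 'v \<Rightarrow> 'k alg_closure" assume i: "i \<in> {1..n}"
  define P where "P \<tau> = (\<Prod>j\<in>{1..n} - {i}. u j (\<tau> j))" for \<tau>
  have "ext_br (u(i := v)) = (\<Sum>\<tau>\<in>{1..n} \<rightarrow>\<^sub>E Basis. wscale (v (\<tau> i) * P \<tau>) (coords (br \<tau>)))" for v
  proof -
    have "(\<Prod>j\<in>{1..n}. (u(i := v)) j (\<tau> j)) = v (\<tau> i) * P \<tau>" for \<tau>
      unfolding P_def prod.remove[OF finite_atLeastAtMost i]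
      by (intro arg_cong2[where f = "(*)"] prod.cong) auto
    then show ?thesis by (simp only: ext_br_def)
  qed
  note e = this
  show "W.endo (\<lambda>v. ext_br (u(i := v)))"
    unfolding W.lin_iff e
  proof safe
    fix v w
    show "(\<Sum>\<tau>\<in>{1..n} \<rightarrow>\<^sub>E Basis. wscale ((v + w) (\<tau> i) * P \<tau>) (coords (br \<tau>)))
      = (\<Sum>\<tau>\<in>{1..n} \<rightarrow>\<^sub>E Basis. wscale (v (\<tau> i) * P \<tau>) (coords (br \<tau>)))
        + (\<Sum>\<tau>\<in>{1..n} \<rightarrow>\<^sub>E Basis. wscale (w (\<tau> i) * P \<tau>) (coords (br \<tau>)))"
      by (simp add: distrib_right W.scale_left_distrib sum.distrib)
  next
    fix c v
    show "(\<Sum>\<tau>\<in>{1..n} \<rightarrow>\<^sub>E Basis. wscale (wscale c v (\<tau> i) * P \<tau>) (coords (br \<tau>)))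
      = wscale c (\<Sum>\<tau>\<in>{1..n} \<rightarrow>\<^sub>E Basis. wscale (v (\<tau> i) * P \<tau>) (coords (br \<tau>)))"
      unfolding W.scale_sum_right W.scale_scale by (simp only: wscale_def[of c v] mult.assoc)
  qed
qed

lemma ext_br_expand:
  assumes "\<And>i b. i \<in> {1..n} \<Longrightarrow> b \<in> Basis \<Longrightarrow> u i b = (\<Sum>a\<in>Basis. wscale (c i a) (F i a)) b"
  shows "ext_br u = (\<Sum>\<tau>\<in>{1..n} \<rightarrow>\<^sub>E Basis. wscale (\<Prod>i\<in>{1..n}. c i (\<tau> i)) (ext_br (\<lambda>i. F i (\<tau> i))))"
proof -
  have "ext_br u = ext_br (\<lambda>i. \<Sum>a\<in>Basis. wscale (c i a) (F i a))"
    using assms by (rule ext_br_cong)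
  then show ?thesis by (simp only: W.br_sum_all[OF finite_Basis] W.br_scale_all)
qed

lemma ext_br_coords: "ext_br (\<lambda>i. coords (x i)) = coords (br x)"
proof -
  have "coords (br x) = coords (br (\<lambda>i. \<Sum>b\<in>Basis. scale (coord (x i) b) b))" by (simp add: coord_expand)
  also have "\<dots> = (\<Sum>\<tau>\<in>{1..n} \<rightarrow>\<^sub>E Basis. wscale (\<Prod>i\<in>{1..n}. to_ac (coord (x i) (\<tau> i))) (coords (br \<tau>)))"
    by (simp only: br_sum_all[OF finite_Basis] br_scale_all coords_sum coords_scale to_ac_prod)
  also have "\<dots> = ext_br (\<lambda>i. coords (x i))" by (simp only: ext_br_def coords_def[of "x _"])
  finally show ?thesis ..
qed

text \<open>All terms expand over the same basis tuples with the same coefficients, and on a basis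
  tuple the identity is the rule for \<open>f\<close>.\<close>

lemma ext_op_leibniz:
  assumes f: "endo f" and rule: "leibniz_rule f (\<lambda>_. f)"
  shows "W.leibniz_rule (ext_op f) (\<lambda>_. ext_op f)"
  unfolding W.leibniz_rule_def
proof
  fix u :: "nat \<Rightarrow> 'v \<Rightarrow> 'k alg_closure"
  define c where "c \<tau> = (\<Prod>i\<in>{1..n}. u i (\<tau> i))" for \<tau>
  have i: "ext_br (u(i := ext_op f (u i))) = (\<Sum>\<tau>\<in>{1..n} \<rightarrow>\<^sub>E Basis. wscale (c \<tau>) (coords (br (\<tau>(i := f (\<tau> i))))))"
    if "i \<in> {1..n}" for i
  proof -
    have "ext_br (u(i := ext_op f (u i)))
      = (\<Sum>\<tau>\<in>{1..n} \<rightarrow>\<^sub>E Basis. wscale (\<Prod>i\<in>{1..n}. u i (\<tau> i))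
          (ext_br (\<lambda>j. (if j = i then coords (f (\<tau> j)) else coords (\<tau> j)))))"
    proof (rule ext_br_expand)
      fix j b assume b: "b \<in> Basis"
      show "(u(i := ext_op f (u i))) j b = (\<Sum>a\<in>Basis. wscale (u j a) (if j = i then coords (f a) else coords a)) b"
        using basis_expand[OF b, of "u j"] by (cases "j = i") (simp_all add: ext_op_def)
    qed
    also have "\<dots> = (\<Sum>\<tau>\<in>{1..n} \<rightarrow>\<^sub>E Basis. wscale (c \<tau>) (ext_br (\<lambda>j. coords ((\<tau>(i := f (\<tau> i))) j))))"
      unfolding c_def by (intro sum.cong refl arg_cong2[where f = wscale] ext_br_cong) auto
    finally show ?thesis by (simp only: ext_br_coords)
  qed
  have "ext_op f (ext_br u) = (\<Sum>\<tau>\<in>{1..n} \<rightarrow>\<^sub>E Basis. wscale (c \<tau>) (coords (f (br \<tau>))))"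
    by (simp add: ext_br_def W.lin_sum[OF lin_ext_op] W.lin_scale[OF lin_ext_op] ext_op_coords[OF f] c_def del: One_nat_def)
  also have "\<dots> = (\<Sum>\<tau>\<in>{1..n} \<rightarrow>\<^sub>E Basis. \<Sum>i\<in>{1..n}. wscale (c \<tau>) (coords (br (\<tau>(i := f (\<tau> i))))))"
    by (simp only: rule[unfolded leibniz_rule_def, rule_format] coords_sum W.scale_sum_right)
  also have "\<dots> = (\<Sum>i\<in>{1..n}. ext_br (u(i := ext_op f (u i))))"
    by (subst sum.swap) (intro sum.cong refl i[symmetric])
  finally show "ext_op f (ext_br u) = (\<Sum>i\<in>{1..n}. ext_br (u(i := ext_op f (u i))))" .
qed

text \<open>The first \<open>card Basis + 1\<close> members of the sequence are dependent; cutting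
  at the last nonzero coefficient keeps a witness that the relation is nontrivial.\<close>

lemma linear_relation:
  fixes f :: "nat \<Rightarrow> 'v"
  obtains c m where "c m \<noteq> 0" "(\<Sum>i\<le>m. scale (c i) (f i)) = 0"
proof -
  define M where "M = card Basis"
  have "\<exists>c. (\<exists>i\<le>M. c i \<noteq> 0) \<and> (\<Sum>i\<le>M. scale (c i) (f i)) = 0"
  proof (cases "inj_on f {..M}")
    case True
    have "dependent (f ` {..M})"
    proof (rule ccontr)
      assume "independent (f ` {..M})"
      then have "card (f ` {..M}) \<le> card Basis"
        using independent_span_bound[OF finite_Basis] span_Basis by auto
      then show False using card_image[OF True] by (simp add: M_def)
    qed
    then obtain u where "\<exists>v\<in>f ` {..M}. u v \<noteq> 0" "(\<Sum>v\<in>f ` {..M}. scale (u v) v) = 0"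
      by (auto simp: dependent_finite)
    then show ?thesis using sum.reindex[OF True, of "\<lambda>v. scale (u v) v"]
      by (intro exI[of _ "u \<circ> f"]) auto
  next
    \<comment> \<open>A repetition is invisible in the image set, so here the relation is the
      difference of the two equal members.\<close>
    case False
    then obtain i j where ij: "i \<le> M" "j \<le> M" "i \<noteq> j" "f i = f j" by (auto simp: inj_on_def)
    define c :: "nat \<Rightarrow> 'k" where "c k = (if k = i then 1 else 0) - (if k = j then 1 else 0)" for k
    have "(\<Sum>k\<le>M. scale (c k) (f k)) = (\<Sum>k\<le>M. if k = i then f i else 0) - (\<Sum>k\<le>M. if k = j then f j else 0)"
      unfolding sum_subtractf[symmetric] by (intro sum.cong) (auto simp: c_def scale_left_diff_distrib)
    then show ?thesis using ij by (intro exI[of _ c]) (auto simp: c_def)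
  qed
  then obtain c i where c: "i \<le> M" "c i \<noteq> 0" "(\<Sum>i\<le>M. scale (c i) (f i)) = 0" by blast
  define m where "m = Max {i. i \<le> M \<and> c i \<noteq> 0}"
  have m: "m \<in> {i. i \<le> M \<and> c i \<noteq> 0}" unfolding m_def by (rule Max_in) (use c in auto)
  have "(\<Sum>i\<le>M. scale (c i) (f i)) = (\<Sum>i\<le>m. scale (c i) (f i))"
  proof (rule sum.mono_neutral_right)
    show "\<forall>i\<in>{..M} - {..m}. scale (c i) (f i) = 0"
    proof
      fix i assume "i \<in> {..M} - {..m}"
      then have "c i = 0" using Max_ge[of "{i. i \<le> M \<and> c i \<noteq> 0}" i] by (auto simp: m_def)
      then show "scale (c i) (f i) = 0" by simp
    qed
  qed (use m in auto)
  then have "(\<Sum>i\<le>m. scale (c i) (f i)) = 0" using c(3) by simp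
  moreover have "c m \<noteq> 0" using m by simp
  ultimately show ?thesis by (intro that[of c m])
qed

text \<open>In place of a characteristic polynomial: a relation between the iterates of
  \<open>f\<close> on \<open>b\<close> is a nonzero polynomial in \<open>f\<close> killing
  \<open>b\<close>, and it splits into linear factors over the closure.\<close>

lemma ext_op_splits_basis:
  assumes f: "endo f"
  shows "\<exists>l. foldr (W.shift (ext_op f)) l (coords b) = 0"
proof -
  obtain c m where c: "c m \<noteq> 0" "(\<Sum>i\<le>m. scale (c i) ((f ^^ i) b)) = 0"
    by (rule linear_relation[of "\<lambda>i. (f ^^ i) b"])
  define p where "p = (\<Sum>i\<le>m. monom (to_ac (c i)) i)"
  have cp: "coeff p i = (if i \<le> m then to_ac (c i) else 0)" for i
    by (simp add: p_def coeff_sum)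
  have dp: "degree p \<le> m" by (rule degree_le) (simp add: cp)
  have p: "p \<noteq> 0" using c(1) cp[of m] by auto
  have it: "(ext_op f ^^ i) (coords b) = coords ((f ^^ i) b)" for i
    by (induction i) (simp_all add: ext_op_coords[OF f])
  have "W.poly_act (ext_op f) p (coords b) = coords (\<Sum>i\<le>m. scale (c i) ((f ^^ i) b))"
    by (simp add: W.poly_act_eq[OF lin_ext_op dp] cp it coords_sum coords_scale)
  then have z: "W.poly_act (ext_op f) p (coords b) = 0" by (simp add: c(2) coords_zero)
  obtain A where A: "p = smult (lead_coeff p) (\<Prod>x\<in>#A. [:-x, 1:])"
    using alg_closed_imp_factorization[OF p] by blast
  obtain l where l: "mset l = A" by (metis ex_mset)
  have "(\<Prod>x\<in>#A. [:-x, 1:]) = (\<Prod>x\<leftarrow>l. [:-x, 1:])"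
    unfolding l[symmetric] by (simp only: mset_map[symmetric] prod_mset_prod_list)
  note pl = A[unfolded this]
  define a q where "a = lead_coeff p" and q: "q = (\<Prod>x\<leftarrow>l. [:-x, 1:])"
  have pq: "p = smult a q" unfolding a_def q by (rule pl)
  have a: "a \<noteq> 0" using p by (simp add: a_def)
  have "W.poly_act (ext_op f) p (coords b) = wscale a (W.poly_act (ext_op f) q (coords b))"
    unfolding W.poly_act_def[OF lin_ext_op] pq using a
    by (simp only: degree_smult_eq coeff_smult W.scale_sum_right W.scale_scale if_False)
  then have "W.poly_act (ext_op f) q (coords b) = 0" using z a by simp
  then show ?thesis using W.poly_act_split[OF lin_ext_op, of f l "coords b"] by (auto simp: q)
qed

lemma ext_op_splits:
  assumes f: "endo f"
  obtains l where "2 \<le> length l" "\<And>u. foldr (W.shift (ext_op f)) l u = 0"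
proof -
  define L where "L b = (SOME l. foldr (W.shift (ext_op f)) l (coords b) = 0)" for b
  have L: "foldr (W.shift (ext_op f)) (L b) (coords b) = 0" for b
    unfolding L_def by (rule someI_ex) (rule ext_op_splits_basis[OF f])
  obtain bs where bs: "set bs = Basis" using finite_list[OF finite_Basis] by blast
  define l where "l = concat (map L bs)"
  have lin: "W.endo (foldr (W.shift (ext_op f)) l)" by (rule W.lin_foldr_shift[OF lin_ext_op])
  have "foldr (W.shift (ext_op f)) l (coords b) = 0" if "b \<in> Basis" for b
    unfolding l_def by (rule W.foldr_shift_concat[OF lin_ext_op _ L]) (use that bs in simp)
  note e = this
  have "foldr (W.shift (ext_op f)) l (\<Sum>a\<in>Basis. wscale (c a) (coords a)) = 0" for c
    unfolding W.lin_sum[OF lin] W.lin_scale[OF lin] by (rule sum.neutral) (simp add: e)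
  from this[of "coords _"] have coords: "foldr (W.shift (ext_op f)) l (coords x) = 0" for x
    by (simp only: coords_sum_basis)
  have 0: "foldr (W.shift (ext_op f)) l (ext_op f u) = 0" for u
    unfolding ext_op_def[of f u] W.lin_sum[OF lin] W.lin_scale[OF lin]
    by (rule sum.neutral) (simp add: coords)
  have "W.shift (ext_op f) 0 u = ext_op f u" for u by (simp add: W.shift_def)
  \<comment> \<open>The factor at 0 applied first moves an arbitrary function into the span of the
    coordinate vectors, which \<open>l\<close> kills. The second 0 guarantees length 2, so that the
    truncated exponential retains its linear term.\<close>
  then have "foldr (W.shift (ext_op f)) (l @ [0, 0]) u = 0" for u by (simp add: 0)
  then show ?thesis by (rule that[of "l @ [0, 0]", rotated]) simp
qed

end

section \<open>Derivations preserve automorphism-stable subspaces\<close>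

context vector_space_operators
begin

lemma separating_functional:
  assumes J: "subspace J" and y: "y \<notin> J"
  shows "\<exists>\<phi> :: 'b \<Rightarrow> 'a. (\<forall>u v. \<phi> (u + v) = \<phi> u + \<phi> v) \<and> (\<forall>c v. \<phi> (scale c v) = c * \<phi> v) \<and>
    (\<forall>v\<in>J. \<phi> v = 0) \<and> \<phi> y = 1"
proof -
  interpret P: vector_space_pair scale "(*) :: 'a \<Rightarrow> 'a \<Rightarrow> 'a"
    by unfold_locales (auto simp: algebra_simps)
  obtain B where B: "B \<subseteq> J" "independent B" "J \<subseteq> span B"
    by (rule maximal_independent_subset)
  have "span B = J" using B J by (simp add: span_subspace)
  then have ind: "independent (insert y B)" using y B by (intro independent_insertI) auto
  obtain \<phi> where \<phi>: "Vector_Spaces.linear scale (*) \<phi>" "\<forall>v\<in>insert y B. \<phi> v = (if v = y then 1 else 0)"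
    using P.linear_independent_extend[OF ind, of "\<lambda>v. if v = y then 1 else 0"] by blast
  have "\<phi> b = 0" if "b \<in> B" for b using \<phi>(2) y B(1) that by auto
  then have "\<phi> v = 0" if "v \<in> J" for v
    using P.linear_eq_0_on_span[OF \<phi>(1), of B v] that B(3) by blast
  then show ?thesis
    using \<phi> by (intro exI[of _ \<phi>]) (simp add: P.linear_add P.linear_scale)
qed

end

lemma coeff_mult_1: "coeff (p * q) 1 = coeff p 0 * coeff q 1 + coeff p 1 * coeff q 0"
  for p q :: "'a::comm_semiring_1 poly"
  by (simp add: coeff_mult)

lemma coeff_linear_power:
  fixes b :: "'a::comm_ring_1"
  shows "coeff ([:1, - b:] ^ m) 0 = 1" "coeff ([:1, - b:] ^ m) 1 = - (of_nat m * b)"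
proof -
  show 0: "coeff ([:1, - b:] ^ m) 0 = 1" for m by (simp add: coeff_0_power)
  show "coeff ([:1, - b:] ^ m) 1 = - (of_nat m * b)"
  proof (induction m)
    case (Suc m)
    have "coeff ([:1, - b:] ^ Suc m) 1 = coeff ([:1, - b:] ^ m) 1 - b * coeff ([:1, - b:] ^ m) 0"
      by (simp only: power_Suc coeff_mult_1) simp
    then show ?case unfolding Suc.IH 0 by (simp add: algebra_simps)
  qed simp
qed

text \<open>Coefficients 0 and 1 are the value and the derivative at t = 0; as all factors have
  value 1 there, the derivatives add up.\<close>

lemma coeff_linear_power_prod:
  fixes m :: "'a::comm_ring_1 \<Rightarrow> nat"
  assumes "finite S"
  shows "coeff (\<Prod>b\<in>S. [:1, - b:] ^ m b) 0 = 1 \<and>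
    coeff (\<Prod>b\<in>S. [:1, - b:] ^ m b) 1 = - (\<Sum>b\<in>S. of_nat (m b) * b)"
  using assms
proof (induction S rule: finite_induct)
  case (insert b S)
  have "coeff (\<Prod>b\<in>insert b S. [:1, - b:] ^ m b) 0 = 1"
    using insert by (simp add: coeff_mult coeff_linear_power)
  moreover have "coeff (\<Prod>b\<in>insert b S. [:1, - b:] ^ m b) 1 = - (\<Sum>b\<in>insert b S. of_nat (m b) * b)"
    unfolding prod.insert[OF insert.hyps] sum.insert[OF insert.hyps] coeff_mult_1 coeff_linear_power
    using insert.IH by simp
  ultimately show ?case ..
qed simp

section \<open>Descent and the curve of automorphisms attached to a derivation\<close>

locale finite_dim_derivation = finite_dim_algebra scale n br Basis
  for scale :: "'k::field_char_0 \<Rightarrow> 'v::ab_group_add \<Rightarrow> 'v" and n br Basis +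
  fixes f :: "'v \<Rightarrow> 'v" and l :: "'k alg_closure list"
  assumes lin_f: "endo f" and leibniz_f: "leibniz_rule f (\<lambda>_. f)"
    and length_l: "2 \<le> length l" and l: "foldr (W.shift (ext_op f)) l u = 0"
begin

sublocale S: split_derivation wscale n ext_br "ext_op f" l
proof (intro split_derivation.intro split_operator.intro split_operator_axioms.intro
    split_derivation_axioms.intro W.n_ary_algebra_axioms W.vector_space_operators_axioms)
  show "W.endo (ext_op f)" by (rule lin_ext_op)
  show "foldr (W.shift (ext_op f)) l u = 0" for u by (rule l)
  show "1 \<le> n" by (rule n)
  show "W.leibniz_rule (ext_op f) (\<lambda>_. ext_op f)" by (rule ext_op_leibniz[OF lin_f leibniz_f])
qed

lemma ext_op_apply: "ext_op f u b = (\<Sum>a\<in>Basis. u a * to_ac (coord (f a) b))"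
  by (simp only: ext_op_def sum_fun_apply wscale_def coords_def)

lemma conj_add: "embedding_over_base \<sigma> \<Longrightarrow> (\<lambda>b. \<sigma> ((u + v) b)) = (\<lambda>b. \<sigma> (u b)) + (\<lambda>b. \<sigma> (v b))"
  and conj_scale: "embedding_over_base \<sigma> \<Longrightarrow> (\<lambda>b. \<sigma> (wscale k u b)) = wscale (\<sigma> k) (\<lambda>b. \<sigma> (u b))"
  and conj_ext_op: "embedding_over_base \<sigma> \<Longrightarrow> (\<lambda>b. \<sigma> (ext_op f u b)) = ext_op f (\<lambda>b. \<sigma> (u b))"
  by (rule ext, simp only: plus_fun_apply wscale_def ext_op_apply embedding_add embedding_mult embedding_sum embedding_to_ac)+

lemma embedding_spec: "embedding_over_base \<sigma> \<Longrightarrow> \<sigma> ` S.spec \<subseteq> S.spec"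
proof (rule S.semilinear_spec[OF conj_add conj_scale conj_ext_op])
  assume \<sigma>: "embedding_over_base \<sigma>"
  show "inj (\<lambda>(u :: 'v \<Rightarrow> 'k alg_closure) b. \<sigma> (u b))"
    by (rule injI, rule ext) (metis inj_embedding[OF \<sigma>] injD)
qed

text \<open>Galois descent: an operator commuting with all embeddings of the algebraic closure is
  defined over the base field.\<close>

lemma descend_automorphism:
  assumes g: "\<And>\<alpha>. (\<And>i. i \<in> {1..n} \<Longrightarrow> \<alpha> i \<in> S.spec) \<Longrightarrow> (\<Sum>i\<in>{1..n}. \<alpha> i) \<in> S.spec \<Longrightarrow>
      g (\<Sum>i\<in>{1..n}. \<alpha> i) = (\<Prod>i\<in>{1..n}. g (\<alpha> i))"
    and g0: "\<And>\<alpha>. \<alpha> \<in> S.spec \<Longrightarrow> g \<alpha> \<noteq> 0"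
    and equi: "\<And>\<sigma> \<alpha>. embedding_over_base \<sigma> \<Longrightarrow> \<alpha> \<in> S.spec \<Longrightarrow> g (\<sigma> \<alpha>) = \<sigma> (g \<alpha>)"
    and c: "\<And>\<sigma>. embedding_over_base \<sigma> \<Longrightarrow> \<sigma> c = c"
  shows "\<exists>a. endo a \<and> bij a \<and> (\<forall>x. a (br x) = br (\<lambda>i. a (x i))) \<and>
    (\<forall>x. coords (a x) = S.spectral_exp g c (coords x))"
proof -
  let ?A = "S.spectral_exp g c"
  \<comment> \<open>Embeddings commute with the operator and fix the coordinates of
    \<open>x\<close>, hence also those of its image, which therefore lie in the base.\<close>
  have fixed: "\<sigma> (?A (coords x) b) = ?A (coords x) b" if \<sigma>: "embedding_over_base \<sigma>" for \<sigma> x b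
  proof -
    have "(\<lambda>b. \<sigma> (?A (coords x) b)) = ?A (\<lambda>b. \<sigma> (coords x b))"
      by (rule S.spectral_exp_equivariant[where \<tau> = "\<lambda>u b. \<sigma> (u b)" and \<sigma> = \<sigma>])
        (rule conj_add[OF \<sigma>] conj_scale[OF \<sigma>] conj_ext_op[OF \<sigma>] embedding_mult[OF \<sigma>]
          embedding_inverse_fact[OF \<sigma>] embedding_1[OF \<sigma>] equi[OF \<sigma>] c[OF \<sigma>] | assumption)+
    also have "(\<lambda>b. \<sigma> (coords x b)) = coords x" by (simp only: coords_def embedding_to_ac[OF \<sigma>])
    finally show ?thesis by (rule fun_cong)
  qed
  \<comment> \<open>The image must be a genuine coordinate vector, hence zero off the basis. Cutting
    a function down to the basis commutes with the extended operator and fixes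
    \<open>coords x\<close>, so it also fixes its image.\<close>
  have support: "?A (coords x) b = 0" if "b \<notin> Basis" for x b
  proof -
    define \<rho> where "\<rho> u = (\<lambda>b. if b \<in> Basis then u b else 0)" for u :: "'v \<Rightarrow> 'k alg_closure"
    have "\<rho> (?A (coords x)) = ?A (\<rho> (coords x))"
    proof (rule S.spectral_exp_equivariant[where \<sigma> = "\<lambda>k. k"])
      show "\<rho> (u + v) = \<rho> u + \<rho> v" for u v by (rule ext) (simp add: \<rho>_def)
      show "\<rho> (wscale k u) = wscale k (\<rho> u)" for k u by (rule ext) (simp add: \<rho>_def wscale_def)
      show "\<rho> (ext_op f u) = ext_op f (\<rho> u)" for u
        by (rule ext) (simp add: \<rho>_def ext_op_apply coord_notin)
    qed (rule refl)+
    also have "\<rho> (coords x) = coords x" by (rule ext) (simp add: \<rho>_def coords_def coord_notin)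
    finally show ?thesis using that by (metis \<rho>_def)
  qed
  define a where "a x = (\<Sum>b\<in>Basis. scale (of_ac (?A (coords x) b)) b)" for x
  have coords_a: "coords (a x) = ?A (coords x)" for x
  proof
    fix b
    have "coord (a x) b = (\<Sum>b'\<in>Basis. of_ac (?A (coords x) b') * coord b' b)"
      unfolding a_def using span_Basis by (simp add: representation_sum[OF indep_Basis] coord_scale)
    also have "\<dots> = (\<Sum>b'\<in>Basis. if b' = b then of_ac (?A (coords x) b) else 0)"
      by (intro sum.cong refl) (simp add: coord_basis)
    also have "\<dots> = (if b \<in> Basis then of_ac (?A (coords x) b) else 0)" using finite_Basis by simp
    also have "to_ac \<dots> = ?A (coords x) b"
      using fixed_by_embeddings_imp_base[of "?A (coords x) b"] fixed support[of b x] to_ac_of_ac by auto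
    finally show "coords (a x) b = ?A (coords x) b" by (simp only: coords_def)
  qed
  have lin_a: "endo a"
    unfolding lin_iff
  proof safe
    fix x y show "a (x + y) = a x + a y"
      by (rule coords_inj) (simp only: coords_add coords_a W.lin_add[OF S.lin_spectral_exp])
  next
    fix k x show "a (scale k x) = scale k (a x)"
      by (rule coords_inj) (simp only: coords_scale coords_a W.lin_scale[OF S.lin_spectral_exp])
  qed
  have inj: "inj a"
  proof (rule injI)
    fix x y assume "a x = a y"
    then have "a (x - y) = 0" by (simp add: lin_diff[OF lin_a])
    then have "?A (coords (x - y)) = 0" using coords_a[of "x - y"] by (simp only: coords_zero)
    then have "coords (x - y) = coords 0" unfolding coords_zero by (rule S.spectral_exp_inj[rotated]) (rule g0)
    then show "x = y" using coords_inj by (metis right_minus_eq)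
  qed
  have fd: "finite_dimensional_vector_space scale Basis"
    by unfold_locales (rule finite_Basis indep_Basis span_Basis)+
  have "surj a" by (rule finite_dimensional_vector_space.linear_inj_imp_surj[OF fd lin_a inj])
  have hom: "a (br x) = br (\<lambda>i. a (x i))" for x
    by (rule coords_inj) (simp only: coords_a ext_br_coords[symmetric] S.spectral_exp_br[OF g])
  show ?thesis using lin_a hom coords_a inj \<open>surj a\<close> unfolding bij_def by blast
qed

text \<open>If \<open>f x\<close> were outside \<open>J\<close>, a functional \<phi> vanishing on
  \<open>J\<close> would take the value 1 on it. Evaluating \<phi> along the curve of automorphisms
  applied to \<open>x\<close> gives zero for almost all t, while its derivative at t = 0 is
  -N.\<close>

lemma preserves_automorphism_stable:
  assumes J: "subspace J"
    and stable: "\<And>a x. endo a \<Longrightarrow> bij a \<Longrightarrow> (\<And>x. a (br x) = br (\<lambda>i. a (x i))) \<Longrightarrow> x \<in> J \<Longrightarrow> a x \<in> J"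
    and x: "x \<in> J"
  shows "f x \<in> J"
proof (rule ccontr)
  assume "f x \<notin> J"
  then obtain \<phi> where \<phi>_add: "\<And>u v. \<phi> (u + v) = \<phi> u + \<phi> v" and \<phi>_scale: "\<And>c v. \<phi> (scale c v) = c * \<phi> v"
    and \<phi>_J: "\<And>v. v \<in> J \<Longrightarrow> \<phi> v = 0" and \<phi>_fx: "\<phi> (f x) = 1"
    using separating_functional[OF J] by blast
  \<comment> \<open>Extension of \<phi> to the closure, so that it can be applied to each
    eigencomponent of \<open>x\<close> separately.\<close>
  define \<Phi> where "\<Phi> u = (\<Sum>b\<in>Basis. u b * to_ac (\<phi> b))" for u
  have \<Phi>_add: "\<Phi> (u + v) = \<Phi> u + \<Phi> v" for u v by (simp add: \<Phi>_def distrib_right sum.distrib)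
  have \<Phi>_scale: "\<Phi> (wscale c u) = c * \<Phi> u" for c u
    by (simp add: \<Phi>_def wscale_def sum_distrib_left mult.assoc)
  have \<Phi>_0: "\<Phi> 0 = 0" using \<Phi>_scale[of 0 0] by simp
  have \<Phi>_sum: "\<Phi> (sum h A) = (\<Sum>s\<in>A. \<Phi> (h s))" for h :: "'s \<Rightarrow> _" and A
    by (induction A rule: infinite_finite_induct) (simp_all only: sum.infinite sum.empty sum.insert \<Phi>_0 \<Phi>_add not_False_eq_True)
  have \<phi>_sum: "\<phi> (sum h A) = (\<Sum>s\<in>A. \<phi> (h s))" for h :: "'v \<Rightarrow> 'v" and A
    using \<phi>_scale[of 0 0] by (induction A rule: infinite_finite_induct) (simp_all add: \<phi>_add)
  have \<Phi>_coords: "\<Phi> (coords y) = to_ac (\<phi> y)" for y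
  proof -
    have "\<phi> y = (\<Sum>b\<in>Basis. coord y b * \<phi> b)"
      by (subst coord_expand[symmetric]) (simp only: \<phi>_sum \<phi>_scale)
    then show ?thesis by (simp add: \<Phi>_def coords_def to_ac_sum)
  qed
  show False
  proof (rule canonical_integral_coordinates[OF S.finite_spec])
    fix C :: "'k alg_closure \<Rightarrow> 'k alg_closure \<Rightarrow> int" and N :: nat
    assume N: "N > 0"
      and C_repr: "\<And>\<alpha>. \<alpha> \<in> S.spec \<Longrightarrow> (\<Sum>\<beta>\<in>S.spec. of_int (C \<alpha> \<beta>) * \<beta>) = of_nat N * \<alpha>"
      and C_sum: "\<And>(I :: nat set) x \<beta>. finite I \<Longrightarrow> (\<And>i. i \<in> I \<Longrightarrow> x i \<in> S.spec) \<Longrightarrow> sum x I \<in> S.spec \<Longrightarrow>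
          \<beta> \<in> S.spec \<Longrightarrow> C (sum x I) \<beta> = (\<Sum>i\<in>I. C (x i) \<beta>)"
      and C_equi: "\<And>\<sigma> \<alpha> \<beta>. inj \<sigma> \<Longrightarrow> \<sigma> ` S.spec \<subseteq> S.spec \<Longrightarrow> (\<And>a b. \<sigma> (a + b) = \<sigma> a + \<sigma> b) \<Longrightarrow>
          (\<And>r a. \<sigma> (of_rat r * a) = of_rat r * \<sigma> a) \<Longrightarrow> \<alpha> \<in> S.spec \<Longrightarrow> \<beta> \<in> S.spec \<Longrightarrow> C (\<sigma> \<alpha>) (\<sigma> \<beta>) = C \<alpha> \<beta>"
    define g where "g t \<alpha> = (\<Prod>\<beta>\<in>S.spec. (1 - of_nat t * \<beta>) powi C \<alpha> \<beta>)" for t :: nat and \<alpha>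
    \<comment> \<open>Away from zeros of the factors, negative powers are harmless and
      \<open>g t\<close> is nonzero; only finitely many t are lost.\<close>
    define good where "good t \<longleftrightarrow> (\<forall>\<beta>\<in>S.spec. 1 - of_nat t * \<beta> \<noteq> 0)" for t :: nat
    have vanish: "\<Phi> (S.spectral_exp (g t) (- (of_nat t * of_nat N)) (coords x)) = 0" if t: "good t" for t
    proof -
      have "\<exists>a. endo a \<and> bij a \<and> (\<forall>x. a (br x) = br (\<lambda>i. a (x i))) \<and>
        (\<forall>x. coords (a x) = S.spectral_exp (g t) (- (of_nat t * of_nat N)) (coords x))"
      proof (rule descend_automorphism[of "g t" "- (of_nat t * of_nat N)"])
        fix \<alpha> assume \<alpha>: "\<And>i. i \<in> {1..n} \<Longrightarrow> \<alpha> i \<in> S.spec" "(\<Sum>i\<in>{1..n}. \<alpha> i) \<in> S.spec"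
        have "(1 - of_nat t * \<beta>) powi C (\<Sum>i\<in>{1..n}. \<alpha> i) \<beta> = (\<Prod>i\<in>{1..n}. (1 - of_nat t * \<beta>) powi C (\<alpha> i) \<beta>)"
          if \<beta>: "\<beta> \<in> S.spec" for \<beta>
        proof -
          have "1 - of_nat t * \<beta> \<noteq> 0" using t \<beta> by (simp add: good_def)
          then have "(1 - of_nat t * \<beta>) powi (\<Sum>i\<in>A. C (\<alpha> i) \<beta>) = (\<Prod>i\<in>A. (1 - of_nat t * \<beta>) powi C (\<alpha> i) \<beta>)" for A
            by (induction A rule: infinite_finite_induct) (simp_all add: power_int_add)
          then show ?thesis using C_sum[of "{1..n}" \<alpha> \<beta>] \<alpha> \<beta> by simp
        qed
        then show "g t (\<Sum>i\<in>{1..n}. \<alpha> i) = (\<Prod>i\<in>{1..n}. g t (\<alpha> i))"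
          unfolding g_def by (subst prod.swap) (rule prod.cong[OF refl])
      next
        fix \<alpha> assume "\<alpha> \<in> S.spec"
        then show "g t \<alpha> \<noteq> 0" using t S.finite_spec by (simp add: g_def good_def)
      next
        fix \<sigma> :: "'k alg_closure \<Rightarrow> 'k alg_closure" and \<alpha> assume \<sigma>: "embedding_over_base \<sigma>" and \<alpha>: "\<alpha> \<in> S.spec"
        have im: "\<sigma> ` S.spec \<subseteq> S.spec" by (rule embedding_spec[OF \<sigma>])
        have bij: "bij_betw \<sigma> S.spec S.spec"
          unfolding bij_betw_def using endo_inj_surj[OF S.finite_spec im] inj_embedding[OF \<sigma>]
          by (metis inj_on_subset subset_UNIV)
        have sc: "\<sigma> (of_rat r * b) = of_rat r * \<sigma> b" for r b by (simp only: embedding_mult[OF \<sigma>] embedding_of_rat[OF \<sigma>])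
        have "g t (\<sigma> \<alpha>) = (\<Prod>\<beta>\<in>S.spec. (1 - of_nat t * \<sigma> \<beta>) powi C (\<sigma> \<alpha>) (\<sigma> \<beta>))"
          unfolding g_def by (rule prod.reindex_bij_betw[OF bij, symmetric])
        also have "\<dots> = (\<Prod>\<beta>\<in>S.spec. (1 - of_nat t * \<sigma> \<beta>) powi C \<alpha> \<beta>)"
          by (intro prod.cong refl) (simp only: C_equi[OF inj_embedding[OF \<sigma>] im embedding_add[OF \<sigma>] sc \<alpha>])
        also have "\<dots> = \<sigma> (g t \<alpha>)"
          by (simp only: g_def embedding_prod[OF \<sigma>] embedding_power_int[OF \<sigma>] embedding_diff[OF \<sigma>] embedding_1[OF \<sigma>] embedding_mult[OF \<sigma>] embedding_of_nat[OF \<sigma>])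
        finally show "g t (\<sigma> \<alpha>) = \<sigma> (g t \<alpha>)" .
      next
        fix \<sigma> :: "'k alg_closure \<Rightarrow> 'k alg_closure" assume \<sigma>: "embedding_over_base \<sigma>"
        show "\<sigma> (- (of_nat t * of_nat N)) = - (of_nat t * of_nat N)"
          by (simp only: embedding_uminus[OF \<sigma>] embedding_mult[OF \<sigma>] embedding_of_nat[OF \<sigma>])
      qed
      then obtain a where a: "endo a" "bij a" "\<And>x. a (br x) = br (\<lambda>i. a (x i))"
        "\<And>x. coords (a x) = S.spectral_exp (g t) (- (of_nat t * of_nat N)) (coords x)" by blast
      have "\<phi> (a x) = 0" using stable[OF a(1-3) x] \<phi>_J by blast
      then show ?thesis using \<Phi>_coords[of "a x"] a(4) by simp
    qed
    \<comment> \<open>Large enough that all exponents \<open>M + C \<alpha> \<beta>\<close> are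
      nonnegative: multiplication by the \<open>M\<close>-th power of the product of all factors
      clears the denominators.\<close>
    define M where "M = nat (\<Sum>\<alpha>\<in>S.spec. \<Sum>\<beta>\<in>S.spec. \<bar>C \<alpha> \<beta>\<bar>)"
    define m where "m \<alpha> \<beta> = nat (int M + C \<alpha> \<beta>)" for \<alpha> \<beta>
    have m: "int (m \<alpha> \<beta>) = int M + C \<alpha> \<beta>" if "\<alpha> \<in> S.spec" "\<beta> \<in> S.spec" for \<alpha> \<beta>
    proof -
      have "\<bar>C \<alpha> \<beta>\<bar> \<le> (\<Sum>\<beta>\<in>S.spec. \<bar>C \<alpha> \<beta>\<bar>)" using that S.finite_spec by (intro member_le_sum) auto
      also have "\<dots> \<le> (\<Sum>\<alpha>\<in>S.spec. \<Sum>\<beta>\<in>S.spec. \<bar>C \<alpha> \<beta>\<bar>)"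
        using that S.finite_spec by (intro member_le_sum[of \<alpha> _ "\<lambda>\<alpha>. \<Sum>\<beta>\<in>S.spec. \<bar>C \<alpha> \<beta>\<bar>"]) (auto intro: sum_nonneg)
      finally have le: "\<bar>C \<alpha> \<beta>\<bar> \<le> (\<Sum>\<alpha>\<in>S.spec. \<Sum>\<beta>\<in>S.spec. \<bar>C \<alpha> \<beta>\<bar>)" .
      then have "int M = (\<Sum>\<alpha>\<in>S.spec. \<Sum>\<beta>\<in>S.spec. \<bar>C \<alpha> \<beta>\<bar>)" unfolding M_def by linarith
      then have "0 \<le> int M + C \<alpha> \<beta>" using le by linarith
      then show ?thesis unfolding m_def by (rule int_nat_eq[THEN trans, OF if_P])
    qed
    define y where "y = S.component (coords x)"
    define Q where "Q \<alpha> = (\<Prod>\<beta>\<in>S.spec. [:1, - \<beta>:] ^ m \<alpha> \<beta>)" for \<alpha>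
    define w where "w \<alpha> k = (- of_nat N) ^ k * inverse (fact k) * \<Phi> ((W.shift (ext_op f) \<alpha> ^^ k) (y \<alpha>))" for \<alpha> k
    define E where "E \<alpha> = (\<Sum>k<length l. monom (w \<alpha> k) k)" for \<alpha>
    \<comment> \<open>At a good t its value is that common factor times \<Phi> of the transformed
      \<open>x\<close>. Unlike the latter expression, \<open>p\<close> also makes sense at t =
      0.\<close>
    define p where "p = (\<Sum>\<alpha>\<in>S.spec. Q \<alpha> * E \<alpha>)"
    have root: "poly p (of_nat t) = 0" if t: "good t" for t
    proof -
      define \<chi> where "\<chi> = (\<Prod>\<beta>\<in>S.spec. 1 - of_nat t * \<beta>)"
      have Q: "poly (Q \<alpha>) (of_nat t) = \<chi> ^ M * g t \<alpha>" if \<alpha>: "\<alpha> \<in> S.spec" for \<alpha>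
      proof -
        have "(1 - of_nat t * \<beta>) ^ m \<alpha> \<beta> = (1 - of_nat t * \<beta>) ^ M * (1 - of_nat t * \<beta>) powi C \<alpha> \<beta>"
          if \<beta>: "\<beta> \<in> S.spec" for \<beta>
        proof -
          have "1 - of_nat t * \<beta> \<noteq> 0" using t \<beta> by (simp add: good_def)
          then have "(1 - of_nat t * \<beta>) powi int (m \<alpha> \<beta>)
              = (1 - of_nat t * \<beta>) powi int M * (1 - of_nat t * \<beta>) powi C \<alpha> \<beta>"
            unfolding m[OF \<alpha> \<beta>] by (simp add: power_int_add)
          then show ?thesis by simp
        qed
        then have "(\<Prod>\<beta>\<in>S.spec. (1 - of_nat t * \<beta>) ^ m \<alpha> \<beta>) = \<chi> ^ M * g t \<alpha>"
          by (simp add: g_def \<chi>_def prod_power_distrib prod.distrib)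
        then show ?thesis by (simp add: Q_def poly_prod)
      qed
      have E: "poly (E \<alpha>) (of_nat t) = \<Phi> (W.exp_trunc (W.shift (ext_op f) \<alpha>) (- (of_nat t * of_nat N)) (length l) (y \<alpha>))" for \<alpha>
      proof -
        have "- (of_nat t * of_nat N) = - of_nat N * (of_nat t :: 'k alg_closure)"
          by (simp add: mult.commute)
        then have pw: "(- (of_nat t * of_nat N)) ^ k = (- of_nat N) ^ k * (of_nat t :: 'k alg_closure) ^ k" for k
          by (simp only: power_mult_distrib)
        show ?thesis
          unfolding E_def w_def W.exp_trunc_def \<Phi>_sum \<Phi>_scale poly_sum poly_monom
          unfolding pw by (intro sum.cong refl) (simp only: mult_ac)
      qed
      have "poly p (of_nat t) = (\<Sum>\<alpha>\<in>S.spec. \<chi> ^ M * (g t \<alpha> * poly (E \<alpha>) (of_nat t)))"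
        by (simp add: p_def poly_sum Q mult.assoc)
      also have "\<dots> = \<chi> ^ M * \<Phi> (S.spectral_exp (g t) (- (of_nat t * of_nat N)) (coords x))"
        unfolding S.spectral_exp_def \<Phi>_sum \<Phi>_scale E y_def sum_distrib_left ..
      also have "\<dots> = 0" by (simp only: vanish[OF t] mult_zero_right)
      finally show ?thesis .
    qed
    have "p = 0"
    proof (rule ccontr)
      assume "p \<noteq> 0"
      then have fin: "finite {z. poly p z = 0}" by (rule poly_roots_finite)
      have "{t. \<not> good t} \<subseteq> (\<lambda>t. of_nat t) -` (inverse ` S.spec)"
      proof
        fix t assume "t \<in> {t. \<not> good t}"
        then obtain \<beta> where "\<beta> \<in> S.spec" "of_nat t * \<beta> = 1" by (auto simp: good_def)
        moreover from this have "of_nat t = inverse \<beta>" by (metis inverse_unique mult.commute)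
        ultimately show "t \<in> (\<lambda>t. of_nat t) -` (inverse ` S.spec)" by simp
      qed
      moreover have "finite ((\<lambda>t. of_nat t :: 'k alg_closure) -` (inverse ` S.spec))"
        using S.finite_spec by (intro finite_vimageI) (auto intro: injI)
      ultimately have "finite {t. \<not> good t}" by (rule finite_subset)
      moreover have "finite {t. good t}"
        by (rule finite_subset[OF _ finite_vimageI[OF fin, of "of_nat"]]) (auto intro: injI root)
      moreover have "UNIV = {t. good t} \<union> {t. \<not> good t}" by blast
      ultimately show False using infinite_UNIV_nat by (metis finite_Un)
    qed
    \<comment> \<open>The linear coefficient is the derivative at t = 0. The length of
      \<open>l\<close> ensures that \<open>E\<close> really has its terms of degree 0 and 1.\<close>
    then have "0 = coeff p 1" by simp
    also have "\<dots> = (\<Sum>\<alpha>\<in>S.spec. w \<alpha> 1 - (\<Sum>\<beta>\<in>S.spec. of_nat (m \<alpha> \<beta>) * \<beta>) * w \<alpha> 0)"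
    proof -
      have E: "coeff (E \<alpha>) k = w \<alpha> k" if "k < 2" for \<alpha> k
        using that length_l by (simp add: E_def coeff_sum)
      show ?thesis
        unfolding p_def coeff_sum coeff_mult_1 Q_def
        by (intro sum.cong refl) (simp only: coeff_linear_power_prod[OF S.finite_spec] E, simp add: E)
    qed
    \<comment> \<open>The part \<open>N * \<alpha>\<close> of the weighted eigenvalue sum cancels
      the \<alpha> in the shift. What the denominators leave behind is independent of \<alpha>, so
      it sums to a multiple of \<Phi> on \<open>coords x\<close>, which is zero.\<close>
    also have "\<dots> = (\<Sum>\<alpha>\<in>S.spec. - of_nat N * \<Phi> (ext_op f (y \<alpha>)) - of_nat M * (\<Sum>\<beta>\<in>S.spec. \<beta>) * \<Phi> (y \<alpha>))"
    proof (rule sum.cong[OF refl])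
      fix \<alpha> assume \<alpha>: "\<alpha> \<in> S.spec"
      have "(\<Sum>\<beta>\<in>S.spec. of_nat (m \<alpha> \<beta>) * \<beta>) = (\<Sum>\<beta>\<in>S.spec. of_int (int (m \<alpha> \<beta>)) * \<beta>)" by simp
      also have "\<dots> = (\<Sum>\<beta>\<in>S.spec. of_nat M * \<beta> + of_int (C \<alpha> \<beta>) * \<beta>)"
        by (intro sum.cong refl) (simp only: m[OF \<alpha>] of_int_add of_int_of_nat_eq distrib_right)
      also have "\<dots> = of_nat M * (\<Sum>\<beta>\<in>S.spec. \<beta>) + of_nat N * \<alpha>"
        by (simp only: sum.distrib sum_distrib_left C_repr[OF \<alpha>])
      finally have "(\<Sum>\<beta>\<in>S.spec. of_nat (m \<alpha> \<beta>) * \<beta>) = of_nat M * (\<Sum>\<beta>\<in>S.spec. \<beta>) + of_nat N * \<alpha>" .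
      moreover have "\<Phi> (ext_op f (y \<alpha>)) = \<Phi> (W.shift (ext_op f) \<alpha> (y \<alpha>)) + \<alpha> * \<Phi> (y \<alpha>)"
        unfolding \<Phi>_add[symmetric] \<Phi>_scale[symmetric] by (simp add: W.shift_def)
      ultimately show "w \<alpha> 1 - (\<Sum>\<beta>\<in>S.spec. of_nat (m \<alpha> \<beta>) * \<beta>) * w \<alpha> 0
        = - of_nat N * \<Phi> (ext_op f (y \<alpha>)) - of_nat M * (\<Sum>\<beta>\<in>S.spec. \<beta>) * \<Phi> (y \<alpha>)"
        by (simp add: w_def algebra_simps)
    qed
    also have "\<dots> = - of_nat N * \<Phi> (ext_op f (sum y S.spec)) - of_nat M * (\<Sum>\<beta>\<in>S.spec. \<beta>) * \<Phi> (sum y S.spec)"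
      by (simp only: sum_subtractf sum_distrib_left \<Phi>_sum W.lin_sum[OF lin_ext_op])
    also have "sum y S.spec = coords x" by (simp only: y_def S.component)
    also have "\<Phi> (ext_op f (coords x)) = 1" by (simp only: ext_op_coords[OF lin_f] \<Phi>_coords \<phi>_fx to_ac_1)
    also have "\<Phi> (coords x) = 0" by (simp only: \<Phi>_coords \<phi>_J[OF x] to_ac_0)
    finally show False using N by simp
  qed
qed

end

lemma (in finite_dim_algebra) derivation_preserves_automorphism_stable:
  assumes "endo f" "leibniz_rule f (\<lambda>_. f)" "subspace J"
    and "\<And>a x. endo a \<Longrightarrow> bij a \<Longrightarrow> (\<And>x. a (br x) = br (\<lambda>i. a (x i))) \<Longrightarrow> x \<in> J \<Longrightarrow> a x \<in> J"
    and "x \<in> J"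
  shows "f x \<in> J"
proof -
  show ?thesis
  proof (rule ext_op_splits[OF assms(1)])
    fix l assume l: "2 \<le> length l" "\<And>u. foldr (W.shift (ext_op f)) l u = 0"
    interpret finite_dim_derivation scale n br Basis f l
      by (intro finite_dim_derivation.intro finite_dim_derivation_axioms.intro finite_dim_algebra_axioms)
        (fact assms l)+
    show ?thesis by (rule preserves_automorphism_stable[OF assms(3) _ assms(5)]) (rule assms(4))
  qed
qed


section \<open>The nilradicals\<close>

context leibniz_n_algebra
begin

context
  fixes a
  assumes lin_a: "Vector_Spaces.linear scale scale a" and bij_a: "bij a"
    and hom_a: "\<And>x. a (br x) = br (\<lambda>i. a (x i))"
begin

lemma automorphism_span: "span (a ` S) = a ` span S"
  using module_hom.span_image[OF lin_a[folded module_hom_eq_linear]] .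

lemma automorphism_zero: "a 0 = 0"
  using module_hom.zero[OF lin_a[folded module_hom_eq_linear]] .

lemma automorphism_lift:  "\<exists>y. \<forall>i. x i = a (y i)"
  using bij_a by (intro exI[of _ "\<lambda>i. inv_into UNIV a (x i)"]) (simp add: bij_is_surj surj_f_inv_f)

text \<open>Surjectivity lifts the tuple, injectivity places the lifted entries in the sets
  \<open>A i\<close>. Both series are built from this operation and spans, so an automorphism
  carries them along.\<close>

lemma automorphism_bracket_span: "bracket_span (\<lambda>i. a ` A i) = a ` bracket_span A"
proof -
  have "{br x |x. \<forall>i\<in>{1..n}. x i \<in> a ` A i} = a ` {br x |x. \<forall>i\<in>{1..n}. x i \<in> A i}"
  proof safe
    fix x assume x: "\<forall>i\<in>{1..n}. x i \<in> a ` A i"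
    obtain y where y: "\<And>i. x i = a (y i)" using automorphism_lift[of x] by blast
    have "\<forall>i\<in>{1..n}. y i \<in> A i"
    proof
      fix i assume "i \<in> {1..n}"
      then obtain z where "z \<in> A i" "a (y i) = a z" using x y by (metis imageE)
      then show "y i \<in> A i" using bij_is_inj[OF bij_a] by (simp add: inj_eq)
    qed
    moreover have "br x = a (br y)" unfolding hom_a y[symmetric] ..
    ultimately show "br x \<in> a ` {br x |x. \<forall>i\<in>{1..n}. x i \<in> A i}" by blast
  next
    fix x assume "\<forall>i\<in>{1..n}. x i \<in> A i"
    then show "\<exists>y. a (br x) = br y \<and> (\<forall>i\<in>{1..n}. y i \<in> a ` A i)"
      by (intro exI[of _ "\<lambda>i. a (x i)"]) (simp add: hom_a)
  qed
  then show ?thesis by (simp only: bracket_span_def automorphism_span)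
qed

lemma automorphism_bracket_span_upd:
  "bracket_span ((\<lambda>_. a ` H)(i := a ` K)) = a ` bracket_span ((\<lambda>_. H)(i := K))"
proof -
  have "(\<lambda>_. a ` H)(i := a ` K) = (\<lambda>j. a ` (((\<lambda>_. H)(i := K)) j))"
    by (rule ext) simp
  then show ?thesis by (simp only: automorphism_bracket_span)
qed

lemma automorphism_subspace_sum: "subspace_sum ((`) a ` \<S>) = a ` subspace_sum \<S>"
  by (simp only: subspace_sum_def automorphism_span flip: image_Union)

lemma automorphism_s_series: "s_series s (a ` H) m = a ` s_series s H m"
  by (induction m) (simp_all add: automorphism_bracket_span_upd)

lemma automorphism_lower_series: "lower_series (a ` H) m = a ` lower_series H m"
proof (induction m)
  case (Suc m)
  have "(\<lambda>i. bracket_span ((\<lambda>_. a ` H)(i := a ` lower_series H m))) ` {1..n}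
    = (`) a ` ((\<lambda>i. bracket_span ((\<lambda>_. H)(i := lower_series H m))) ` {1..n})"
    by (simp only: automorphism_bracket_span_upd image_image)
  then show ?case by (simp only: lower_series.simps Suc.IH automorphism_subspace_sum)
qed simp

lemma automorphism_ideal:
  assumes "leibniz_ideal I" shows "leibniz_ideal (a ` I)"
  unfolding leibniz_ideal_def
proof (intro conjI allI impI)
  have "span I = I" using assms by (simp add: leibniz_ideal_def span_eq_iff)
  then show "subspace (a ` I)" by (metis automorphism_span subspace_span)
next
  fix x assume "\<exists>i\<in>{1..n}. x i \<in> a ` I"
  then obtain i where i: "i \<in> {1..n}" "x i \<in> a ` I" by blast
  obtain y where y: "\<And>i. x i = a (y i)" using automorphism_lift[of x] by blast
  have "y i \<in> I" using i(2) bij_is_inj[OF bij_a] by (auto simp: y inj_eq)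
  then have "br y \<in> I" using assms i(1) unfolding leibniz_ideal_def by blast
  moreover have "br x = a (br y)" unfolding hom_a y[symmetric] ..
  ultimately show "br x \<in> a ` I" by blast
qed

lemma automorphism_s_nilpotent: "s_nilpotent s H \<Longrightarrow> s_nilpotent s (a ` H)"
  by (auto simp: s_nilpotent_def automorphism_s_series automorphism_zero) (metis automorphism_zero image_empty image_insert)

lemma automorphism_nilpotent: "nilpotent H \<Longrightarrow> nilpotent (a ` H)"
  by (auto simp: nilpotent_def automorphism_lower_series) (metis automorphism_zero image_empty image_insert)

lemma automorphism_stable_sum:
  assumes "\<And>I. I \<in> \<S> \<Longrightarrow> a ` I \<in> \<S>" and "x \<in> subspace_sum \<S>"
  shows "a x \<in> subspace_sum \<S>"
proof -
  have "a x \<in> subspace_sum ((`) a ` \<S>)" using assms(2) by (simp add: automorphism_subspace_sum)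
  also have "\<dots> \<subseteq> subspace_sum \<S>"
    unfolding subspace_sum_def by (intro span_mono Union_mono) (use assms(1) in blast)
  finally show ?thesis .
qed

end

end

theorem theorem4p12:
  fixes scale :: "'k::field_char_0 \<Rightarrow> 'v::ab_group_add \<Rightarrow> 'v"
    and n s :: nat
    and br :: "(nat \<Rightarrow> 'v) \<Rightarrow> 'v"
    and Basis :: "'v set"
  assumes "leibniz_n_algebra scale n br"
    and "finite_dimensional_vector_space scale Basis"
    and "1 \<le> s" and "s \<le> n"
  shows "(\<forall>d. leibniz_n_algebra.derivation scale n br d \<longrightarrow>
            d ` leibniz_n_algebra.s_nilradical scale n br s
              \<subseteq> leibniz_n_algebra.s_nilradical scale n br s)
       \<and> (\<forall>d. leibniz_n_algebra.derivation scale n br d \<longrightarrow>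
            d ` leibniz_n_algebra.nilradical scale n br
              \<subseteq> leibniz_n_algebra.nilradical scale n br)"
proof -
  interpret L: leibniz_n_algebra scale n br by (rule assms(1))
  interpret F: finite_dimensional_vector_space scale Basis by (rule assms(2))
  interpret A: finite_dim_algebra scale n br Basis
    by (intro finite_dim_algebra.intro finite_dim_algebra_axioms.intro n_ary_algebra.intro
        n_ary_algebra_axioms.intro vector_space_operators.intro L.vector_space_axioms
        L.bracket_cong L.bracket_linear F.finite_Basis F.independent_Basis F.span_Basis)
      (use assms(3,4) in simp_all)
  have sub: "L.subspace (L.subspace_sum \<S>)" for \<S> by (simp add: L.subspace_sum_def)
  \<comment> \<open>Both radicals are sums over a family that automorphisms map into itself; the
    argument uses nothing else about the family.\<close>
  have *: "d ` L.subspace_sum \<S> \<subseteq> L.subspace_sum \<S>"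
    if d: "L.derivation d"
      and \<S>: "\<And>a I. A.endo a \<Longrightarrow> bij a \<Longrightarrow> (\<And>x. a (br x) = br (\<lambda>i. a (x i))) \<Longrightarrow> I \<in> \<S> \<Longrightarrow> a ` I \<in> \<S>"
    for d \<S>
  proof clarify
    fix x assume x: "x \<in> L.subspace_sum \<S>"
    show "d x \<in> L.subspace_sum \<S>"
    proof (rule A.derivation_preserves_automorphism_stable[OF _ _ sub _ x])
      show "A.endo d" "A.leibniz_rule d (\<lambda>_. d)" using d by (auto simp: L.derivation_def A.leibniz_rule_def)
      show "a x \<in> L.subspace_sum \<S>"
        if "A.endo a" "bij a" "\<And>x. a (br x) = br (\<lambda>i. a (x i))" "x \<in> L.subspace_sum \<S>" for a x
        using L.automorphism_stable_sum[OF that(1-3) \<S>[OF that(1-3)] that(4)] .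
    qed
  qed
  show ?thesis
    unfolding L.s_nilradical_def L.nilradical_def
    by (intro conjI allI impI *)
      (auto intro: L.automorphism_ideal L.automorphism_s_nilpotent L.automorphism_nilpotent)
qed

end
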